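(* Let $n\ge 0$, $d\ge 2$ be integers and let $S,T\in \mathrm{Sym}^d\mathbb{C}^{n+1}$. Then $\mathrm{sgr}(S+T)\leq \mathrm{sgr}(S)+\mathrm{sgr}(T)$.
   Context: For $T=(t_{i_1,\dots,i_d})\in \mathrm{Sym}^d\mathbb{C}^{n+1}$ (coordinates with respect to the canonical basis), the associated homogeneous degree $d$ polynomial is $F(x)=\sum t_{i_1,\dots,i_d}x_{i_1}\cdots x_{i_d}\in\mathbb{C}[x_0,\dots,x_n]_d$. The symmetric geometric rank is $\mathrm{sgr}(T)=\mathrm{codim}\{x\in\mathbb{C}^{n+1} : \frac{\partial F}{\partial x_0}(x)=\cdots=\frac{\partial F}{\partial x_n}(x)=0\}$ (codimension in $\mathbb{C}^{n+1}$); equivalently, it is the codimension in $\mathbb{P}^n$ of the singular locus $\{[x]\in\mathbb{P}^n:\frac{\partial F}{\partial x_i}(x)=0\ \forall i\}$, with the convention that the empty set has codimension $n+1$ in $\mathbb{P}^n$. *)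

theory Defs
  imports
    "HOL-Analysis.Finite_Cartesian_Product"
    "HOL-Library.Poly_Mapping"
    "HOL-Library.Multiset"
    "HOL-Library.Function_Algebras"
    "HOL-Library.Extended_Nat"
    Complex_Main
begin

text \<open>
  The space $C^{n+1}$ is \<^typ>\<open>complex ^ 'n\<close> with \<open>CARD('n) = n + 1\<close>; its coordinates are
  indexed by the elements of \<^typ>\<open>'n\<close>.  As types are nonempty, this covers exactly $n \ge 0$.
\<close>

subsection \<open>Polynomials in the coordinates\<close>

text \<open>A polynomial maps exponent vectors to coefficients.\<close>

type_synonym 'n cpoly = "('n \<Rightarrow>\<^sub>0 nat) \<Rightarrow>\<^sub>0 complex"

definition eval_poly :: "'n::finite cpoly \<Rightarrow> complex ^ 'n \<Rightarrow> complex" where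
  "eval_poly p x =
     (\<Sum>m\<in>Poly_Mapping.keys p.
        Poly_Mapping.lookup p m * (\<Prod>i\<in>UNIV. (x $ i) ^ Poly_Mapping.lookup m i))"

text \<open>
  Subtraction of exponents truncates, but where it does so the coefficient is \<open>0\<close>.
\<close>

definition partial_deriv :: "'n \<Rightarrow> 'n cpoly \<Rightarrow> 'n cpoly" where
  "partial_deriv i p =
     (\<Sum>m\<in>Poly_Mapping.keys p.
        Poly_Mapping.single (m - Poly_Mapping.single i 1)
          (of_nat (Poly_Mapping.lookup m i) * Poly_Mapping.lookup p m))"

subsection \<open>Krull dimension in the Zariski topology\<close>

definition algebraic_set :: "(complex ^ 'n::finite) set \<Rightarrow> bool" where
  "algebraic_set X \<longleftrightarrow> (\<exists>P. X = {x. \<forall>p\<in>P. eval_poly p x = 0})"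

definition irreducible_algebraic_set :: "(complex ^ 'n::finite) set \<Rightarrow> bool" where
  "irreducible_algebraic_set Z \<longleftrightarrow>
     algebraic_set Z \<and> Z \<noteq> {} \<and>
     (\<forall>A B. algebraic_set A \<and> algebraic_set B \<and> Z = A \<union> B \<longrightarrow> Z = A \<or> Z = B)"

text \<open>
  The supremum of the lengths \<open>k\<close> of strict chains \<open>Z 0 \<subset> \<dots> \<subset> Z k\<close> of irreducible closed subsets
  of \<open>X\<close>; for algebraic \<open>X\<close> these are the irreducible algebraic sets contained in \<open>X\<close>.
\<close>

definition krull_dim :: "(complex ^ 'n::finite) set \<Rightarrow> enat" where
  "krull_dim X =
     Sup {enat k | k. \<exists>Z. (\<forall>i\<le>k. irreducible_algebraic_set (Z i) \<and> Z i \<subseteq> X) \<and>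
                          (\<forall>i<k. Z i \<subset> Z (Suc i))}"

text \<open>
  Codimension in the ambient affine space, for nonempty algebraic \<open>X\<close>.  The empty set gets
  dimension \<open>0\<close> from the supremum above, but the sets used below always contain the origin,
  since the partial derivatives of a form of degree at least \<open>2\<close> vanish there.
\<close>

definition codim :: "(complex ^ 'n::finite) set \<Rightarrow> enat" where
  "codim X = enat CARD('n) - krull_dim X"

subsection \<open>Symmetric tensors and symmetric geometric rank\<close>

text \<open>
  A tensor of order \<open>d\<close> is given by its coordinates, a function on multi-indices
  \<open>[i\<^sub>1, \<dots>, i\<^sub>d]\<close>, extended by \<open>0\<close> to lists of other lengths so that equality of functions is
  equality of tensors.
\<close>

definition symmetric_tensors :: "nat \<Rightarrow> ('n list \<Rightarrow> complex) set" where
  "symmetric_tensors d =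
     {T. (\<forall>I. length I \<noteq> d \<longrightarrow> T I = 0) \<and>
         (\<forall>I J. length I = d \<and> mset I = mset J \<longrightarrow> T I = T J)}"

definition assoc_poly :: "nat \<Rightarrow> ('n::finite list \<Rightarrow> complex) \<Rightarrow> 'n cpoly" where
  "assoc_poly d T =
     (\<Sum>I | length I = d.
        Poly_Mapping.single (\<Sum>i\<leftarrow>I. Poly_Mapping.single i 1) (T I))"

definition sgr :: "nat \<Rightarrow> ('n::finite list \<Rightarrow> complex) \<Rightarrow> enat" where
  "sgr d T = codim {x. \<forall>i. eval_poly (partial_deriv i (assoc_poly d T)) x = 0}"

end

theory Submission
  imports Defs "HOL-Analysis.Analysis" "HOL-Computational_Algebra.Fundamental_Theorem_Algebra"
begin

text \<open>
  Write \<open>N = CARD('n)\<close>.  The partial derivatives are additive in the form, so the singular cone of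
  \<open>S + T\<close> contains the intersection of the singular cones of \<open>S\<close> and \<open>T\<close>.  Everything thus follows from
  the inequality $\dim (X \cap Y) \ge \dim X + \dim Y - N$ for Zariski-closed cones \<open>X\<close> and \<open>Y\<close> that
  contain the origin (\<open>codim_Int_le\<close>), where dimension is the length of chains of irreducible
  algebraic sets.

  Two other quantities mediate between chains in the factors and chains in the intersection: the
  number of polynomial functions that are algebraically independent on a cone, and the number of
  linear forms needed to cut the cone down to the origin.

  \<^item> A chain of length \<open>k\<close> yields \<open>k\<close> algebraically independent functions
    (\<open>irreducible_chain_imp_alg_indep\<close>).

  \<^item> If \<open>m\<close> linear forms cut a cone to the origin, then at most \<open>m\<close> functions are independent on it
    (\<open>alg_indep_length_le\<close>).  By the Nullstellensatz the coordinates are integral over these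
    forms, so the functions of degree at most \<open>t\<close> restrict to a space of dimension $O(t^m)$, whereas
    the monomials in \<open>r\<close> independent functions span a space that grows like $t^r$.

  \<^item> If at least \<open>k\<close> linear forms are needed to cut a cone to the origin, then the cone contains a
    chain of length \<open>k\<close> (\<open>hard_cone_has_chain\<close>).  A minimal cone of this kind exists by compactness
    of the sphere and is irreducible; intersecting it with a hyperplane lowers \<open>k\<close> by at most one.
    Irreducibility needs that a union of two cones is not harder to cut than the harder one of them
    (\<open>cuts_to_origin_Un\<close>).

  Given chains of lengths \<open>a\<close> in \<open>X\<close> and \<open>b\<close> in \<open>Y\<close>, there are \<open>a + b\<close> independent functions on the product
  of \<open>X\<close> and \<open>Y\<close>.  If \<open>m\<close> linear forms cut \<open>X \<inter> Y\<close> to the origin, then these and the \<open>N\<close> equations of the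
  diagonal cut the product to the origin, so \<open>a + b \<le> m + N\<close> (\<open>alg_indep_Int_bound\<close>).  Hence at
  least \<open>a + b - N\<close> forms are needed to cut \<open>X \<inter> Y\<close>, which therefore contains a chain of that length.
\<close>

section \<open>Polynomial functions\<close>

interpretation FV: vector_space "\<lambda>(c::complex) (f::'a \<Rightarrow> complex) x. c * f x"
  by unfold_locales (auto simp: fun_eq_iff algebra_simps)

text \<open>
  Linear dependence of a family, in which two equal members already count as a dependence.  All
  counting arguments below use it with index sets that need not embed into the space.
\<close>

lemma (in vector_space) family_dependent:
  assumes "finite A" "finite W" "card W < card A" and span: "\<And>a. a \<in> A \<Longrightarrow> f a \<in> span W"
  shows "\<exists>c. (\<exists>a\<in>A. c a \<noteq> 0) \<and> (\<Sum>a\<in>A. scale (c a) (f a)) = 0"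
proof (cases "inj_on f A")
  case True
  have "dependent (f ` A)"
  proof (rule ccontr)
    assume "\<not> dependent (f ` A)"
    then have "card (f ` A) \<le> card W"
      using independent_span_bound[OF \<open>finite W\<close>] span by blast
    then show False using True assms(3) by (simp add: card_image)
  qed
  then obtain u v where "v \<in> f ` A" "u v \<noteq> 0" "(\<Sum>v\<in>f ` A. scale (u v) v) = 0"
    using dependent_finite[of "f ` A"] \<open>finite A\<close> by auto
  then show ?thesis
    using True by (intro exI[of _ "u \<circ> f"]) (auto simp: sum.reindex)
next
  case False
  then obtain a b where ab: "a \<in> A" "b \<in> A" "a \<noteq> b" "f a = f b" by (auto simp: inj_on_def)
  define c :: "_ \<Rightarrow> 'a" where "c x = (if x = a then 1 else if x = b then -1 else 0)" for x
  have "(\<Sum>x\<in>A. scale (c x) (f x)) = (\<Sum>x\<in>{a, b}. scale (c x) (f x))"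
    by (rule sum.mono_neutral_right) (use ab \<open>finite A\<close> in \<open>auto simp: c_def\<close>)
  also have "\<dots> = 0" using ab by (simp add: c_def)
  finally show ?thesis using ab by (intro exI[of _ c]) (auto simp: c_def intro!: bexI[of _ a])
qed

lemma sum_fun_apply: "(\<Sum>a\<in>A. f a) x = (\<Sum>a\<in>A. f a x)"
  by (induction A rule: infinite_finite_induct) auto

text \<open>
  A multiset of coordinate indices encodes a monomial: its size is the degree, and divisibility of
  monomials is inclusion of multisets.
\<close>

definition monomial :: "'n::finite multiset \<Rightarrow> complex ^ 'n \<Rightarrow> complex" where
  "monomial M x = (\<Prod>i\<in>#M. x $ i)"

definition polys :: "nat \<Rightarrow> (complex ^ 'n::finite \<Rightarrow> complex) set" where
  "polys t = FV.span (monomial ` {M. size M \<le> t})"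

definition polyfuns :: "(complex ^ 'n::finite \<Rightarrow> complex) set" where
  "polyfuns = (\<Union>t. polys t)"

lemma monomial_union: "monomial (M + N) x = monomial M x * monomial N x"
  by (simp add: monomial_def)

lemma monomial_empty [simp]: "monomial {#} = (\<lambda>x. 1)"
  by (simp add: monomial_def fun_eq_iff)

lemma monomial_replicate: "monomial (replicate_mset k i) x = (x $ i) ^ k"
  by (simp add: monomial_def)

lemma monomial_scale: "monomial M (s *s x) = s ^ size M * monomial M x"
  by (induction M) (auto simp: monomial_def algebra_simps)

lemma polys_induct [consumes 1, case_names zero step]:
  assumes "f \<in> polys t"
    and "Q (\<lambda>x. 0)"
    and "\<And>c M g. size M \<le> t \<Longrightarrow> g \<in> polys t \<Longrightarrow> Q g \<Longrightarrow> Q (\<lambda>x. c * monomial M x + g x)"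
  shows "Q f"
proof -
  have "Q f \<and> f \<in> polys t"
    using assms(1) unfolding polys_def
  proof (induction rule: FV.span_induct_alt)
    case base
    then show ?case using assms(2) FV.span_zero by (auto simp: zero_fun_def)
  next
    case (step c m g)
    then obtain M where "m = monomial M" "size M \<le> t" by auto
    moreover have "(\<lambda>x. c * m x) + g \<in> FV.span (monomial ` {M. size M \<le> t})"
      using step by (intro FV.span_add FV.span_scale) (auto intro: FV.span_base)
    ultimately show ?case using step assms(3)[of M g c] by (simp add: polys_def plus_fun_def)
  qed
  then show ?thesis by simp
qed

lemma polys_mono: "s \<le> t \<Longrightarrow> polys s \<subseteq> polys t"
  unfolding polys_def by (intro FV.span_mono) auto

lemma monomial_in_polys: "size M \<le> t \<Longrightarrow> monomial M \<in> polys t"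
  unfolding polys_def by (intro FV.span_base) auto

lemma polys_add: "f \<in> polys t \<Longrightarrow> g \<in> polys t \<Longrightarrow> (\<lambda>x. f x + g x) \<in> polys t"
  unfolding polys_def using FV.span_add by (fastforce simp: plus_fun_def)

lemma polys_cmult: "f \<in> polys t \<Longrightarrow> (\<lambda>x. c * f x) \<in> polys t"
  unfolding polys_def by (rule FV.span_scale)

lemma polys_const: "(\<lambda>x. c) \<in> polys t"
  using polys_cmult[OF monomial_in_polys[of "{#}"], of t c] by simp

lemma polys_coord: "0 < t \<Longrightarrow> (\<lambda>x. x $ i) \<in> polys t"
  using monomial_in_polys[of "{#i#}" t] by (simp add: monomial_def[abs_def])

lemma polys_sum: "(\<And>a. a \<in> A \<Longrightarrow> f a \<in> polys t) \<Longrightarrow> (\<lambda>x. \<Sum>a\<in>A. f a x) \<in> polys t"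
  by (induction A rule: infinite_finite_induct) (auto intro!: polys_add polys_const)

lemma polys_mult_mono: "g \<in> polys t \<Longrightarrow> (\<lambda>x. monomial M x * g x) \<in> polys (size M + t)"
proof (induction rule: polys_induct)
  case zero
  then show ?case using polys_const[of 0] by simp
next
  case (step c N g)
  have "(\<lambda>x. c * monomial (M + N) x + monomial M x * g x) \<in> polys (size M + t)"
    using step by (intro polys_add polys_cmult monomial_in_polys) auto
  then show ?case by (simp add: monomial_union algebra_simps)
qed

lemma polys_mult: "f \<in> polys s \<Longrightarrow> g \<in> polys t \<Longrightarrow> (\<lambda>x. f x * g x) \<in> polys (s + t)"
proof (induction rule: polys_induct)
  case zero
  then show ?case using polys_const[of 0] by simp
next
  case (step c M h)
  have "(\<lambda>x. c * (monomial M x * g x) + h x * g x) \<in> polys (s + t)"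
    using step polys_mult_mono[of g t M] polys_mono[of "size M + t" "s + t"]
    by (intro polys_add polys_cmult) auto
  then show ?case by (simp add: algebra_simps)
qed

lemma polyfuns_add: "f \<in> polyfuns \<Longrightarrow> g \<in> polyfuns \<Longrightarrow> (\<lambda>x. f x + g x) \<in> polyfuns"
proof -
  assume "f \<in> polyfuns" "g \<in> polyfuns"
  then obtain s t where "f \<in> polys s" "g \<in> polys t" by (auto simp: polyfuns_def)
  then have "f \<in> polys (max s t)" "g \<in> polys (max s t)" using polys_mono by (metis max.cobounded1 max.cobounded2 subsetD)+
  then show ?thesis using polys_add unfolding polyfuns_def by blast
qed

lemma polyfuns_mult: "f \<in> polyfuns \<Longrightarrow> g \<in> polyfuns \<Longrightarrow> (\<lambda>x. f x * g x) \<in> polyfuns"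
  unfolding polyfuns_def using polys_mult by blast

lemma polyfuns_const: "(\<lambda>x. c) \<in> polyfuns"
  unfolding polyfuns_def using polys_const by blast

lemma polyfuns_coord: "(\<lambda>x. x $ i) \<in> polyfuns"
  unfolding polyfuns_def using polys_coord[of 1 i] by auto

lemma polyfuns_cmult: "f \<in> polyfuns \<Longrightarrow> (\<lambda>x. c * f x) \<in> polyfuns"
  unfolding polyfuns_def using polys_cmult by blast

lemma polyfuns_diff: "f \<in> polyfuns \<Longrightarrow> g \<in> polyfuns \<Longrightarrow> (\<lambda>x. f x - g x) \<in> polyfuns"
  using polyfuns_add[OF _ polyfuns_cmult[of g "-1"], of f] by simp

lemma polyfuns_sum: "(\<And>a. a \<in> A \<Longrightarrow> f a \<in> polyfuns) \<Longrightarrow> (\<lambda>x. \<Sum>a\<in>A. f a x) \<in> polyfuns"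
  by (induction A rule: infinite_finite_induct) (auto intro!: polyfuns_add polyfuns_const)

lemma polyfuns_prod: "(\<And>a. a \<in> A \<Longrightarrow> f a \<in> polyfuns) \<Longrightarrow> (\<lambda>x. \<Prod>a\<in>A. f a x) \<in> polyfuns"
  by (induction A rule: infinite_finite_induct) (auto intro!: polyfuns_mult polyfuns_const)

lemma polyfuns_power: "f \<in> polyfuns \<Longrightarrow> (\<lambda>x. f x ^ k) \<in> polyfuns"
  by (induction k) (auto intro!: polyfuns_mult polyfuns_const)

lemmas polyfuns_intros = polyfuns_add polyfuns_mult polyfuns_const polyfuns_coord polyfuns_cmult
  polyfuns_diff polyfuns_sum polyfuns_prod polyfuns_power

lemma polyfuns_poly: "f \<in> polyfuns \<Longrightarrow> (\<lambda>x. poly q (f x)) \<in> polyfuns"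
  by (induction q) (auto intro!: polyfuns_intros)

lemma polyfuns_induct [consumes 1, case_names zero step]:
  assumes "f \<in> polyfuns"
    and "Q (\<lambda>x. 0)"
    and "\<And>c M g. g \<in> polyfuns \<Longrightarrow> Q g \<Longrightarrow> Q (\<lambda>x. c * monomial M x + g x)"
  shows "Q f"
proof -
  from assms(1) obtain t where "f \<in> polys t" by (auto simp: polyfuns_def)
  then show ?thesis
    by (induction rule: polys_induct) (use assms in \<open>auto simp: polyfuns_def\<close>)
qed

lemma polyfuns_compose:
  assumes "f \<in> polyfuns" and h: "\<And>i. (\<lambda>x. h x $ i) \<in> polyfuns"
  shows "(\<lambda>x. f (h x)) \<in> polyfuns"
  using assms(1)
proof (induction rule: polyfuns_induct)
  case zero
  then show ?case by (rule polyfuns_const)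
next
  case (step c M g)
  have "(\<lambda>x. monomial M (h x)) \<in> polyfuns"
  proof (induction M)
    case empty
    then show ?case by (simp add: polyfuns_const)
  next
    case (add i M)
    then have "(\<lambda>x. h x $ i * monomial M (h x)) \<in> polyfuns" by (intro polyfuns_mult h)
    then show ?case by (simp add: monomial_def)
  qed
  then show ?case using step by (intro polyfuns_add polyfuns_cmult)
qed

text \<open>
  This reduces statements about polynomial functions on a line through the origin to polynomials in
  one variable, where a nonzero polynomial has only finitely many zeros.
\<close>

lemma polyfuns_on_line:
  assumes "f \<in> polyfuns"
  shows "\<exists>q. \<forall>s. f (s *s x) = poly q s"
  using assms
proof (induction rule: polyfuns_induct)
  case zero
  show ?case by (rule exI[of _ 0]) simp
next
  case (step c M g)
  then obtain q where "\<forall>s. g (s *s x) = poly q s" by blast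
  then show ?case
    by (intro exI[of _ "monom (c * monomial M x) (size M) + q"])
      (simp add: poly_monom monomial_scale algebra_simps)
qed

lemma continuous_on_polyfuns: "f \<in> polyfuns \<Longrightarrow> continuous_on S f"
proof (induction rule: polyfuns_induct)
  case (step c M g)
  have "continuous_on S (monomial M)"
  proof (induction M)
    case (add i M)
    then have "continuous_on S (\<lambda>x. x $ i * monomial M x)" by (intro continuous_intros)
    then show ?case by (simp add: monomial_def)
  qed simp
  then show ?case using step by (intro continuous_intros)
qed simp

lemma finite_bounded_multisets: "finite {M::'n::finite multiset. size M \<le> k}"
proof -
  have "{M::'n multiset. size M \<le> k} = mset ` {xs. set xs \<subseteq> UNIV \<and> length xs \<le> k}"
    by (auto, metis (mono_tags, lifting) ex_mset image_eqI mem_Collect_eq size_mset)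
  moreover have "finite {xs::'n list. set xs \<subseteq> UNIV \<and> length xs \<le> k}"
    by (rule finite_lists_length_le) simp
  ultimately show ?thesis by simp
qed

subsection \<open>Evaluation of formal polynomials\<close>

lemma eval_poly_superset:
  assumes "finite K" "Poly_Mapping.keys p \<subseteq> K"
  shows "eval_poly p x = (\<Sum>m\<in>K. Poly_Mapping.lookup p m * (\<Prod>i\<in>UNIV. (x $ i) ^ Poly_Mapping.lookup m i))"
  unfolding eval_poly_def
  by (rule sum.mono_neutral_left) (use assms in \<open>auto simp: in_keys_iff\<close>)

lemma eval_poly_add: "eval_poly (p + q) x = eval_poly p x + eval_poly q x"
proof -
  let ?K = "Poly_Mapping.keys p \<union> Poly_Mapping.keys q"
  have "finite ?K" "Poly_Mapping.keys (p + q) \<subseteq> ?K" by (auto simp: Poly_Mapping.keys_add)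
  then show ?thesis
    by (simp add: eval_poly_superset[of ?K] lookup_add sum.distrib algebra_simps)
qed

lemma eval_poly_single:
  "eval_poly (Poly_Mapping.single m c) x = c * (\<Prod>i\<in>UNIV. (x $ i) ^ Poly_Mapping.lookup m i)"
  by (cases "c = 0") (auto simp: eval_poly_def)

lemma eval_poly_zero [simp]: "eval_poly 0 x = 0"
  by (simp add: eval_poly_def)

lemma eval_poly_sum: "eval_poly (\<Sum>a\<in>A. p a) x = (\<Sum>a\<in>A. eval_poly (p a) x)"
  by (induction A rule: infinite_finite_induct) (auto simp: eval_poly_add)

lemma monomial_eq_prod_power: "monomial M x = (\<Prod>i\<in>UNIV. (x $ i) ^ count M i)"
proof (induction M)
  case (add j M)
  have "(\<Prod>i\<in>UNIV. x $ i ^ count (add_mset j M) i)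
      = (\<Prod>i\<in>UNIV. (if i = j then x $ i else 1) * x $ i ^ count M i)"
    by (rule prod.cong) auto
  also have "\<dots> = x $ j * (\<Prod>i\<in>UNIV. x $ i ^ count M i)"
    by (simp add: prod.distrib prod.delta')
  finally show ?case using add by (simp add: monomial_def)
qed simp

lemma range_eval_poly: "range eval_poly = polyfuns"
proof (intro equalityI subsetI)
  fix f :: "complex ^ 'n \<Rightarrow> complex"
  assume "f \<in> range eval_poly"
  then obtain p where "f = eval_poly p" by auto
  then have "f = (\<lambda>x. \<Sum>m\<in>Poly_Mapping.keys p.
      Poly_Mapping.lookup p m * (\<Prod>i\<in>UNIV. (x $ i) ^ Poly_Mapping.lookup m i))"
    by (simp add: eval_poly_def fun_eq_iff)
  then show "f \<in> polyfuns" by (auto intro!: polyfuns_intros)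
next
  fix f :: "complex ^ 'n \<Rightarrow> complex"
  assume "f \<in> polyfuns"
  then show "f \<in> range eval_poly"
  proof (induction rule: polyfuns_induct)
    case zero
    show ?case by (rule range_eqI[of _ _ 0]) (auto simp: fun_eq_iff)
  next
    case (step c M g)
    then obtain q where q: "g = eval_poly q" by auto
    define m where "m = Abs_poly_mapping (count M)"
    have "Poly_Mapping.lookup m = count M" unfolding m_def by (simp add: lookup_Abs_poly_mapping)
    then have "(\<lambda>x. c * monomial M x + g x) = eval_poly (Poly_Mapping.single m c + q)"
      by (simp add: fun_eq_iff eval_poly_add eval_poly_single q monomial_eq_prod_power)
    then show ?case by blast
  qed
qed

lemma algebraic_set_iff: "algebraic_set X \<longleftrightarrow> (\<exists>F\<subseteq>polyfuns. X = {x. \<forall>f\<in>F. f x = 0})"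
proof
  assume "algebraic_set X"
  then obtain P where "X = {x. \<forall>p\<in>P. eval_poly p x = 0}" by (auto simp: algebraic_set_def)
  then show "\<exists>F\<subseteq>polyfuns. X = {x. \<forall>f\<in>F. f x = 0}"
    using range_eval_poly by (intro exI[of _ "eval_poly ` P"]) auto
next
  assume "\<exists>F\<subseteq>polyfuns. X = {x. \<forall>f\<in>F. f x = 0}"
  then obtain F where F: "F \<subseteq> range eval_poly" "X = {x. \<forall>f\<in>F. f x = 0}"
    using range_eval_poly by blast
  then obtain P where "F = eval_poly ` P" by (auto simp: subset_image_iff)
  with F show "algebraic_set X" unfolding algebraic_set_def by auto
qed

lemma algebraic_setE:
  assumes "algebraic_set X"
  obtains F where "F \<subseteq> polyfuns" "X = {x. \<forall>f\<in>F. f x = 0}"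
  using assms unfolding algebraic_set_iff by (elim exE conjE)

lemma algebraic_setI: "F \<subseteq> polyfuns \<Longrightarrow> X = {x. \<forall>f\<in>F. f x = 0} \<Longrightarrow> algebraic_set X"
  unfolding algebraic_set_iff by (intro exI[of _ F] conjI)

lemma algebraic_set_Inter:
  assumes "\<And>Y. Y \<in> C \<Longrightarrow> algebraic_set Y"
  shows "algebraic_set (\<Inter>C)"
proof (rule algebraic_setI)
  let ?F = "{f \<in> polyfuns. \<exists>Y\<in>C. \<forall>x\<in>Y. f x = 0}"
  show "?F \<subseteq> polyfuns" by auto
  have "x \<in> \<Inter>C \<longleftrightarrow> (\<forall>f\<in>?F. f x = 0)" for x
  proof
    assume "x \<in> \<Inter>C"
    then show "\<forall>f\<in>?F. f x = 0" by auto
  next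
    assume x: "\<forall>f\<in>?F. f x = 0"
    show "x \<in> \<Inter>C"
    proof
      fix Y assume "Y \<in> C"
      obtain F where F: "F \<subseteq> polyfuns" "Y = {x. \<forall>f\<in>F. f x = 0}"
        using assms[OF \<open>Y \<in> C\<close>] by (elim algebraic_setE)
      have "f x = 0" if "f \<in> F" for f
      proof -
        have "\<forall>y\<in>Y. f y = 0" using that F(2) by simp
        then have "f \<in> ?F" using that F(1) \<open>Y \<in> C\<close> by auto
        then show ?thesis using x by simp
      qed
      then show "x \<in> Y" using F(2) by simp
    qed
  qed
  then show "\<Inter>C = {x. \<forall>f\<in>?F. f x = 0}" by (intro set_eqI) (simp only: mem_Collect_eq)
qed

lemma algebraic_set_Int: "algebraic_set X \<Longrightarrow> algebraic_set Y \<Longrightarrow> algebraic_set (X \<inter> Y)"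
  using algebraic_set_Inter[of "{X, Y}"] by auto

lemma algebraic_set_zero_locus: "f \<in> polyfuns \<Longrightarrow> algebraic_set {x. f x = 0}"
  by (rule algebraic_setI[of "{f}"]) auto

lemma algebraic_set_preimage:
  assumes "algebraic_set X" and h: "\<And>i. (\<lambda>x. h x $ i) \<in> polyfuns"
  shows "algebraic_set {x. h x \<in> X}"
proof -
  obtain F where "F \<subseteq> polyfuns" "X = {x. \<forall>f\<in>F. f x = 0}"
    using assms(1) by (elim algebraic_setE)
  then show ?thesis
    using polyfuns_compose[OF _ h] by (intro algebraic_setI[of "(\<lambda>f x. f (h x)) ` F"]) auto
qed

lemma closed_algebraic_set:
  assumes "algebraic_set X"
  shows "closed X"
proof -
  obtain F where F: "F \<subseteq> polyfuns" "X = {x. \<forall>f\<in>F. f x = 0}"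
    using assms by (elim algebraic_setE)
  have "closed {x. f x = 0}" if "f \<in> F" for f
    using that F(1) continuous_on_polyfuns[of f UNIV]
    by (intro closed_Collect_eq) (auto simp: continuous_on_const)
  then have "closed (\<Inter>f\<in>F. {x. f x = 0})" by blast
  moreover have "X = (\<Inter>f\<in>F. {x. f x = 0})" using F(2) by auto
  ultimately show ?thesis by simp
qed

section \<open>Hilbert's Nullstellensatz over the complex numbers\<close>

definition poly_ideal :: "(complex ^ 'n::finite \<Rightarrow> complex) set \<Rightarrow> bool" where
  "poly_ideal J \<longleftrightarrow> (\<lambda>x. 0) \<in> J \<and> (\<forall>f\<in>J. \<forall>g\<in>J. (\<lambda>x. f x + g x) \<in> J) \<and>
     (\<forall>p\<in>polyfuns. \<forall>f\<in>J. (\<lambda>x. p x * f x) \<in> J)"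

lemma poly_idealD:
  assumes "poly_ideal J"
  shows poly_ideal_zero: "(\<lambda>x. 0) \<in> J"
    and poly_ideal_add: "f \<in> J \<Longrightarrow> g \<in> J \<Longrightarrow> (\<lambda>x. f x + g x) \<in> J"
    and poly_ideal_mult: "p \<in> polyfuns \<Longrightarrow> f \<in> J \<Longrightarrow> (\<lambda>x. p x * f x) \<in> J"
  using assms by (auto simp: poly_ideal_def)

lemma poly_ideal_cmult: "poly_ideal J \<Longrightarrow> f \<in> J \<Longrightarrow> (\<lambda>x. c * f x) \<in> J"
  using poly_ideal_mult[OF _ polyfuns_const] by blast

lemma poly_ideal_sum:
  "poly_ideal J \<Longrightarrow> (\<And>a. a \<in> A \<Longrightarrow> f a \<in> J) \<Longrightarrow> (\<lambda>x. \<Sum>a\<in>A. f a x) \<in> J"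
  by (induction A rule: infinite_finite_induct) (auto simp: poly_ideal_zero intro!: poly_ideal_add)

lemma poly_ideal_one_if_unit:
  assumes "poly_ideal J" "(\<lambda>x. c) \<in> J" "c \<noteq> 0"
  shows "(\<lambda>x. 1) \<in> J"
  using poly_ideal_cmult[OF assms(1,2), of "inverse c"] assms(3) by simp

definition ideal_adjoin ::
  "(complex ^ 'n::finite \<Rightarrow> complex) set \<Rightarrow> (complex ^ 'n \<Rightarrow> complex) \<Rightarrow> (complex ^ 'n \<Rightarrow> complex) set" where
  "ideal_adjoin J g = {f. \<exists>j\<in>J. \<exists>p\<in>polyfuns. f = (\<lambda>x. j x + p x * g x)}"

lemma ideal_adjoinI:
  "j \<in> J \<Longrightarrow> p \<in> polyfuns \<Longrightarrow> (\<And>x. f x = j x + p x * g x) \<Longrightarrow> f \<in> ideal_adjoin J g"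
  unfolding ideal_adjoin_def by blast

lemma ideal_adjoin:
  fixes J :: "(complex ^ 'n::finite \<Rightarrow> complex) set"
  assumes J: "poly_ideal J"
  shows poly_ideal_adjoin: "poly_ideal (ideal_adjoin J g)"
    and subset_ideal_adjoin: "J \<subseteq> ideal_adjoin J g"
    and mem_ideal_adjoin: "g \<in> ideal_adjoin J g"
proof -
  show sub: "J \<subseteq> ideal_adjoin J g"
    by (auto intro!: ideal_adjoinI[of _ J "\<lambda>x. 0"] polyfuns_const)
  show "g \<in> ideal_adjoin J g"
    by (auto intro!: ideal_adjoinI[of "\<lambda>x. 0" J "\<lambda>x. 1"] polyfuns_const poly_ideal_zero J)
  show "poly_ideal (ideal_adjoin J g)"
    unfolding poly_ideal_def
  proof (intro conjI ballI)
    show "(\<lambda>x. 0) \<in> ideal_adjoin J g" using sub poly_ideal_zero[OF J] by blast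
  next
    fix f h assume "f \<in> ideal_adjoin J g" "h \<in> ideal_adjoin J g"
    then obtain j p k q where "j \<in> J" "k \<in> J" "p \<in> polyfuns" "q \<in> polyfuns"
      "f = (\<lambda>x. j x + p x * g x)" "h = (\<lambda>x. k x + q x * g x)"
      by (auto simp: ideal_adjoin_def)
    then show "(\<lambda>x. f x + h x) \<in> ideal_adjoin J g"
      by (intro ideal_adjoinI[of "\<lambda>x. j x + k x" J "\<lambda>x. p x + q x"])
        (auto simp: algebra_simps intro: poly_ideal_add[OF J] polyfuns_add)
  next
    fix r f :: "complex ^ 'n \<Rightarrow> complex"
    assume "r \<in> polyfuns" "f \<in> ideal_adjoin J g"
    then obtain j p where "j \<in> J" "p \<in> polyfuns" "f = (\<lambda>x. j x + p x * g x)"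
      by (auto simp: ideal_adjoin_def)
    with \<open>r \<in> polyfuns\<close> show "(\<lambda>x. r x * f x) \<in> ideal_adjoin J g"
      by (intro ideal_adjoinI[of "\<lambda>x. r x * j x" J "\<lambda>x. r x * p x"])
        (simp_all add: poly_ideal_mult[OF J] polyfuns_mult distrib_left mult.assoc)
  qed
qed

text \<open>
  Modulo \<open>J\<close> every \<open>x $ i - c\<close> is a unit, so the linear factors of \<open>q\<close> can be cancelled one after the
  other until a nonzero constant remains in \<open>J\<close>.
\<close>

lemma univariate_in_ideal_imp_one:
  assumes J: "poly_ideal J"
    and unit: "\<And>c. (\<lambda>x. 1) \<in> ideal_adjoin J (\<lambda>x. x $ i - c)"
    and "q \<noteq> 0" "(\<lambda>x. poly q (x $ i)) \<in> J"
  shows "(\<lambda>x. 1) \<in> J"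
  using assms(3,4)
proof (induction "degree q" arbitrary: q rule: less_induct)
  case less
  show ?case
  proof (cases "degree q = 0")
    case True
    then obtain k where "q = [:k:]" by (rule degree_eq_zeroE)
    then show ?thesis using less.prems poly_ideal_one_if_unit[OF J, of k] by auto
  next
    case False
    then have "\<not> constant (poly q)" by (simp add: constant_degree)
    then obtain d where "poly q d = 0" using fundamental_theorem_of_algebra by blast
    then obtain r where r: "q = [:- d, 1:] * r" by (metis dvdE poly_eq_0_iff_dvd)
    then have "r \<noteq> 0" using less.prems by auto
    then have "degree r < degree q" using r by (simp add: degree_mult_eq del: mult_pCons_left)
    obtain j p where jp: "j \<in> J" "p \<in> polyfuns" "(\<lambda>x. 1) = (\<lambda>x. j x + p x * (x $ i - d))"
      using unit[of d] by (auto simp: ideal_adjoin_def)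
    have "poly r (x $ i) = poly r (x $ i) * j x + p x * poly q (x $ i)" for x
    proof -
      have "poly r (x $ i) = poly r (x $ i) * (j x + p x * (x $ i - d))"
        using fun_cong[OF jp(3), of x] by simp
      then show ?thesis unfolding r by (simp add: algebra_simps)
    qed
    then have "(\<lambda>x. poly r (x $ i)) = (\<lambda>x. poly r (x $ i) * j x + p x * poly q (x $ i))"
      by (rule ext)
    moreover have "\<dots> \<in> J"
      using jp less.prems by (intro poly_ideal_add[OF J] poly_ideal_mult[OF J] polyfuns_poly polyfuns_coord)
    ultimately have "(\<lambda>x. poly r (x $ i)) \<in> J" by simp
    then show ?thesis using less.hyps \<open>degree r < degree q\<close> \<open>r \<noteq> 0\<close> by blast
  qed
qed

text \<open>
  The complex numbers are uncountable but there are only countably many degrees, so some degree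
  bound serves infinitely many values of \<open>c\<close>.
\<close>

lemma infinite_fibre_of_degree:
  fixes u :: "complex \<Rightarrow> complex ^ 'n::finite \<Rightarrow> complex"
  assumes "\<And>c. u c \<in> polyfuns"
  shows "\<exists>t. infinite {c. u c \<in> polys t}"
proof (rule ccontr)
  assume "\<not> ?thesis"
  then have "countable (\<Union>t. {c. u c \<in> polys t})"
    by (intro countable_UN) (auto intro: countable_finite)
  moreover have "(\<Union>t. {c. u c \<in> polys t}) = UNIV"
    using assms by (auto simp: polyfuns_def)
  ultimately have "countable (UNIV :: complex set)" by simp
  then show False using uncountable_UNIV_complex by blast
qed

text \<open>
  The heart of the Nullstellensatz.  If no \<open>c\<close> worked, then each \<open>x $ i - c\<close> would have an inverse
  \<open>u c\<close> modulo \<open>J\<close>.  Infinitely many of these inverses have bounded degree and so lie in a space of finite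
  dimension; clearing denominators in a linear relation between them yields a nonzero polynomial in
  \<open>x $ i\<close> alone that belongs to \<open>J\<close>, which the preceding lemma excludes.
\<close>

lemma ideal_specialize_coordinate:
  assumes J: "poly_ideal J" and proper: "(\<lambda>x. 1) \<notin> J"
  shows "\<exists>c. (\<lambda>x. 1) \<notin> ideal_adjoin J (\<lambda>x. x $ i - c)"
proof (rule ccontr)
  assume "\<not> ?thesis"
  then have unit: "(\<lambda>x. 1) \<in> ideal_adjoin J (\<lambda>x. x $ i - c)" for c by blast
  then have "\<forall>c. \<exists>j u. j \<in> J \<and> u \<in> polyfuns \<and> (\<lambda>x. 1) = (\<lambda>x. j x + u x * (x $ i - c))"
    unfolding ideal_adjoin_def by blast
  then obtain j u where ju: "\<And>c. j c \<in> J" "\<And>c. u c \<in> polyfuns"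
    "\<And>c. (\<lambda>x. 1) = (\<lambda>x. j c x + u c x * (x $ i - c))"
    by metis
  have ju_eq: "j c x + u c x * (x $ i - c) = 1" for c x
    using fun_cong[OF ju(3)[of c], of x] by simp
  obtain t where "infinite {c. u c \<in> polys t}" using infinite_fibre_of_degree[of u, OF ju(2)] by blast
  define W where "W = (monomial :: 'a multiset \<Rightarrow> _) ` {M. size M \<le> t}"
  have "finite W" by (simp add: W_def finite_bounded_multisets)
  obtain A where A: "finite A" "card A = Suc (card W)" "A \<subseteq> {c. u c \<in> polys t}"
    using infinite_arbitrarily_large[OF \<open>infinite _\<close>] by blast
  then have "u c \<in> FV.span W" if "c \<in> A" for c using that by (auto simp: polys_def W_def)
  then obtain a c0 where a: "c0 \<in> A" "a c0 \<noteq> 0" "(\<Sum>c\<in>A. (\<lambda>x. a c * u c x)) = 0"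
    using FV.family_dependent[OF A(1) \<open>finite W\<close>, of u] A(2) by auto
  \<comment> \<open>the numerator of \<open>\<Sum>c\<in>A. a c / (X - c)\<close>\<close>
  define q where "q = (\<Sum>c\<in>A. smult (a c) (\<Prod>d\<in>A - {c}. [:- d, 1:]))"
  \<comment> \<open>all summands but the one for \<open>c0\<close> contain the factor \<open>c0 - c0\<close>\<close>
  have "poly q c0 = (\<Sum>c\<in>A. a c * (\<Prod>d\<in>A - {c}. c0 - d))"
    by (simp add: q_def poly_sum poly_prod)
  also have "\<dots> = (\<Sum>c\<in>{c0}. a c * (\<Prod>d\<in>A - {c}. c0 - d))"
    by (rule sum.mono_neutral_right) (use A(1) a(1) in \<open>auto simp: prod_zero_iff\<close>)
  also have "\<dots> \<noteq> 0" using a A(1) by auto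
  finally have "q \<noteq> 0" by auto
  moreover have "(\<lambda>x. poly q (x $ i)) \<in> J"
  proof -
    have "poly q (x $ i) = (\<Sum>c\<in>A. (a c * (\<Prod>d\<in>A - {c}. x $ i - d)) * j c x)" for x
    proof -
      have "(\<Sum>c\<in>A. a c * u c x) = 0"
        using fun_cong[OF a(3), of x] by (simp add: sum_fun_apply)
      have "poly q (x $ i) = (\<Sum>c\<in>A. a c * (\<Prod>d\<in>A - {c}. x $ i - d) * (j c x + u c x * (x $ i - c)))"
        by (simp add: ju_eq q_def poly_sum poly_prod)
      also have "\<dots> = (\<Sum>c\<in>A. (a c * (\<Prod>d\<in>A - {c}. x $ i - d)) * j c x)
          + (\<Sum>c\<in>A. a c * u c x * (\<Prod>d\<in>A. x $ i - d))"
        unfolding sum.distrib[symmetric]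
        by (rule sum.cong) (use A(1) in \<open>auto simp: prod.remove algebra_simps\<close>)
      also have "(\<Sum>c\<in>A. a c * u c x * (\<Prod>d\<in>A. x $ i - d)) = 0"
        unfolding sum_distrib_right[symmetric] using \<open>(\<Sum>c\<in>A. a c * u c x) = 0\<close> by simp
      finally show ?thesis by simp
    qed
    then have "(\<lambda>x. poly q (x $ i)) = (\<lambda>x. \<Sum>c\<in>A. (a c * (\<Prod>d\<in>A - {c}. x $ i - d)) * j c x)"
      by (rule ext)
    moreover have "\<dots> \<in> J"
      by (intro poly_ideal_sum[OF J] poly_ideal_mult[OF J] ju(1) polyfuns_intros)
    ultimately show ?thesis by simp
  qed
  ultimately have "(\<lambda>x. 1) \<in> J" using univariate_in_ideal_imp_one[OF J unit] by blast
  then show False using proper by blast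
qed

lemma monomial_sub_const_in_ideal:
  assumes J: "poly_ideal J" and "\<And>i. (\<lambda>x. x $ i - p $ i) \<in> J"
  shows "(\<lambda>x. monomial M x - monomial M p) \<in> J"
proof (induction M)
  case empty
  then show ?case using poly_ideal_zero[OF J] by simp
next
  case (add i M)
  have "(\<lambda>x. x $ i * (monomial M x - monomial M p) + monomial M p * (x $ i - p $ i)) \<in> J"
    by (intro poly_ideal_add[OF J] poly_ideal_mult[OF J] poly_ideal_cmult[OF J] add assms polyfuns_coord)
  then show ?case by (simp add: monomial_def algebra_simps)
qed

lemma polyfun_sub_const_in_ideal:
  assumes J: "poly_ideal J" and "\<And>i. (\<lambda>x. x $ i - p $ i) \<in> J" and "f \<in> polyfuns"
  shows "(\<lambda>x. f x - f p) \<in> J"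
  using assms(3)
proof (induction rule: polyfuns_induct)
  case zero
  then show ?case using poly_ideal_zero[OF J] by simp
next
  case (step c M g)
  have "(\<lambda>x. c * (monomial M x - monomial M p) + (g x - g p)) \<in> J"
    by (intro poly_ideal_add[OF J] poly_ideal_cmult[OF J] monomial_sub_const_in_ideal assms step)
  then show ?case by (simp add: algebra_simps)
qed

text \<open>
  Specializing the coordinates one by one leads to a proper ideal that contains \<open>x $ i - p $ i\<close> for all
  \<open>i\<close>; modulo this ideal each polynomial function equals its value at \<open>p\<close>.
\<close>

theorem weak_nullstellensatz:
  assumes J: "poly_ideal J" "(\<lambda>x. 1) \<notin> J" and "J \<subseteq> polyfuns"
  shows "\<exists>p. \<forall>f\<in>J. f p = 0"
proof -
  have "\<exists>K c. poly_ideal K \<and> J \<subseteq> K \<and> (\<lambda>x. 1) \<notin> K \<and> (\<forall>i\<in>I. (\<lambda>x. x $ i - c i) \<in> K)"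
    if "finite I" for I :: "'a set"
    using that
  proof induction
    case empty
    then show ?case using J by blast
  next
    case (insert i I)
    then obtain K c where K: "poly_ideal K" "J \<subseteq> K" "(\<lambda>x. 1) \<notin> K" "\<forall>i\<in>I. (\<lambda>x. x $ i - c i) \<in> K"
      by blast
    obtain d where d: "(\<lambda>x. 1) \<notin> ideal_adjoin K (\<lambda>x. x $ i - d)"
      using ideal_specialize_coordinate[OF K(1,3)] by blast
    let ?K = "ideal_adjoin K (\<lambda>x. x $ i - d)"
    have "poly_ideal ?K" "K \<subseteq> ?K" "(\<lambda>x. x $ i - d) \<in> ?K" using ideal_adjoin[OF K(1)] by auto
    then show ?case
      using K d insert.hyps by (intro exI[of _ ?K] exI[of _ "c(i := d)"]) auto
  qed
  from this[of UNIV] obtain K c where K: "poly_ideal K" "J \<subseteq> K" "(\<lambda>x. 1) \<notin> K"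
    "\<And>i. (\<lambda>x. x $ i - c i) \<in> K"
    by auto
  define p where "p = (\<chi> i. c i)"
  have "f p = 0" if "f \<in> J" for f
  proof (rule ccontr)
    assume "f p \<noteq> 0"
    have "(\<lambda>x. f x - f p) \<in> K"
      using polyfun_sub_const_in_ideal[OF K(1), of p f] K(4) that assms(3) by (auto simp: p_def)
    then have "(\<lambda>x. f x + (-1) * (f x - f p)) \<in> K"
      using that K(2) by (intro poly_ideal_add[OF K(1)] poly_ideal_cmult[OF K(1)]) auto
    then have "(\<lambda>x. f p) \<in> K" by simp
    then show False using poly_ideal_one_if_unit[OF K(1)] \<open>f p \<noteq> 0\<close> K(3) by blast
  qed
  then show ?thesis by blast
qed

text \<open>
  The Nullstellensatz for the ideal generated by the functions \<open>g i\<close> and by all polynomial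
  functions that vanish on \<open>X\<close>.
\<close>

corollary nullstellensatz_on_algebraic_set:
  fixes g :: "nat \<Rightarrow> complex ^ 'n::finite \<Rightarrow> complex"
  assumes X: "algebraic_set X" and g: "\<And>i. i < n \<Longrightarrow> g i \<in> polyfuns"
    and no_zero: "\<And>x. x \<in> X \<Longrightarrow> \<exists>i<n. g i x \<noteq> 0"
  shows "\<exists>h. (\<forall>i<n. h i \<in> polyfuns) \<and> (\<forall>x\<in>X. (\<Sum>i<n. g i x * h i x) = 1)"
proof (rule ccontr)
  assume neg: "\<not> ?thesis"
  define J where "J = {f \<in> polyfuns. \<exists>h. (\<forall>i<n. h i \<in> polyfuns) \<and> (\<forall>x\<in>X. f x = (\<Sum>i<n. g i x * h i x))}"
  have JI: "f \<in> J" if "f \<in> polyfuns" "\<And>i. i < n \<Longrightarrow> h i \<in> polyfuns"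
    "\<And>x. x \<in> X \<Longrightarrow> f x = (\<Sum>i<n. g i x * h i x)" for f h
    using that unfolding J_def by (intro CollectI conjI exI[of _ h]) auto
  have JE: "\<exists>h. f \<in> polyfuns \<and> (\<forall>i<n. h i \<in> polyfuns) \<and> (\<forall>x\<in>X. f x = (\<Sum>i<n. g i x * h i x))"
    if "f \<in> J" for f
    using that unfolding J_def by (elim CollectE conjE exE) (intro exI conjI)
  have "poly_ideal J"
    unfolding poly_ideal_def
  proof (intro conjI ballI)
    show "(\<lambda>x. 0) \<in> J"
      by (rule JI[of _ "\<lambda>i x. 0"]) (simp_all add: polyfuns_const)
  next
    fix f f' assume f: "f \<in> J" "f' \<in> J"
    obtain h where h: "f \<in> polyfuns" "\<forall>i<n. h i \<in> polyfuns" "\<forall>x\<in>X. f x = (\<Sum>i<n. g i x * h i x)"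
      using JE[OF f(1)] by (elim exE conjE)
    obtain h' where h': "f' \<in> polyfuns" "\<forall>i<n. h' i \<in> polyfuns" "\<forall>x\<in>X. f' x = (\<Sum>i<n. g i x * h' i x)"
      using JE[OF f(2)] by (elim exE conjE)
    show "(\<lambda>x. f x + f' x) \<in> J"
      by (rule JI[of _ "\<lambda>i x. h i x + h' i x"])
        (use h h' in \<open>simp_all add: polyfuns_add distrib_left sum.distrib\<close>)
  next
    fix p f :: "complex ^ 'n \<Rightarrow> complex"
    assume p: "p \<in> polyfuns" and f: "f \<in> J"
    obtain h where h: "f \<in> polyfuns" "\<forall>i<n. h i \<in> polyfuns" "\<forall>x\<in>X. f x = (\<Sum>i<n. g i x * h i x)"
      using JE[OF f] by (elim exE conjE)
    show "(\<lambda>x. p x * f x) \<in> J"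
      by (rule JI[of _ "\<lambda>i x. p x * h i x"])
        (use h p in \<open>simp_all add: polyfuns_mult sum_distrib_left mult.left_commute\<close>)
  qed
  moreover have "(\<lambda>x. 1) \<notin> J"
  proof
    assume "(\<lambda>x. 1) \<in> J"
    from JE[OF this] obtain h where "\<forall>i<n. h i \<in> polyfuns" "\<forall>x\<in>X. 1 = (\<Sum>i<n. g i x * h i x)"
      by (elim exE conjE)
    then have "(\<forall>i<n. h i \<in> polyfuns) \<and> (\<forall>x\<in>X. (\<Sum>i<n. g i x * h i x) = 1)" by simp
    with neg show False by (elim notE) (rule exI)
  qed
  ultimately obtain p where p: "\<And>f. f \<in> J \<Longrightarrow> f p = 0"
    using weak_nullstellensatz[of J] by (auto simp: J_def)
  obtain F where F: "F \<subseteq> polyfuns" "X = {x. \<forall>f\<in>F. f x = 0}" using X by (elim algebraic_setE)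
  have "f p = 0" if "f \<in> F" for f
  proof (rule p)
    show "f \<in> J"
      by (rule JI[of _ "\<lambda>i x. 0"]) (use that F in \<open>auto simp: polyfuns_const\<close>)
  qed
  then have "p \<in> X" using F(2) by simp
  then obtain k where k: "k < n" "g k p \<noteq> 0" using no_zero by blast
  have "g k \<in> J"
    by (rule JI[of _ "\<lambda>i x. if i = k then 1 else 0"])
      (use k(1) g in \<open>simp_all add: polyfuns_const if_distrib[of "\<lambda>z. _ * z"] sum.delta cong: if_cong\<close>)
  then show False using p k(2) by blast
qed

section \<open>Algebraic dependence on cones\<close>

subsection \<open>Polynomials with list exponents\<close>

fun list_monomial :: "complex list \<Rightarrow> nat list \<Rightarrow> complex" where
  "list_monomial (v # vs) (b # bs) = v ^ b * list_monomial vs bs"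
| "list_monomial _ _ = 1"

definition exponents :: "nat \<Rightarrow> nat \<Rightarrow> nat list set" where
  "exponents T r = {\<beta>. set \<beta> \<subseteq> {..T} \<and> length \<beta> = r}"

text \<open>
  A polynomial of degree at most \<open>T\<close> in each of the variables \<open>vs\<close>, with coefficient \<open>c \<beta>\<close> at the exponent
  vector \<open>\<beta>\<close>.  The nested form matches induction on the list of variables; the form as a sum over
  monomials is proved below.
\<close>

fun list_poly :: "nat \<Rightarrow> complex list \<Rightarrow> (nat list \<Rightarrow> complex) \<Rightarrow> complex" where
  "list_poly T [] c = c []"
| "list_poly T (v # vs) c = (\<Sum>j\<le>T. v ^ j * list_poly T vs (\<lambda>\<beta>. c (j # \<beta>)))"

lemma finite_exponents [simp]: "finite (exponents T r)"
  by (simp add: exponents_def finite_lists_length_eq)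

lemma card_exponents: "card (exponents T r) = (T + 1) ^ r"
  by (simp add: exponents_def card_lists_length_eq)

lemma exponents_mono: "s \<le> T \<Longrightarrow> exponents s r \<subseteq> exponents T r"
  by (auto simp: exponents_def)

lemma exponents_0 [simp]: "exponents T 0 = {[]}"
  by (auto simp: exponents_def)

lemma Cons_in_exponents [simp]: "j # \<beta> \<in> exponents T (Suc r) \<longleftrightarrow> j \<le> T \<and> \<beta> \<in> exponents T r"
  by (auto simp: exponents_def)

lemma exponents_Suc: "exponents T (Suc r) = (\<lambda>(j, \<beta>). j # \<beta>) ` ({..T} \<times> exponents T r)"
  by (auto simp: exponents_def length_Suc_conv image_iff)

lemma exponents_append_split:
  assumes "\<gamma> \<in> exponents T (r + s)"
  obtains \<alpha> \<beta> where "\<gamma> = \<alpha> @ \<beta>" "\<alpha> \<in> exponents T r" "\<beta> \<in> exponents T s"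
proof
  show "\<gamma> = take r \<gamma> @ drop r \<gamma>" by simp
  show "take r \<gamma> \<in> exponents T r" "drop r \<gamma> \<in> exponents T s"
    using assms by (auto simp: exponents_def dest: in_set_takeD in_set_dropD)
qed

lemma list_poly_eq_sum:
  "list_poly T vs c = (\<Sum>\<beta>\<in>exponents T (length vs). c \<beta> * list_monomial vs \<beta>)"
proof (induction vs arbitrary: c)
  case (Cons v vs)
  have inj: "inj_on (\<lambda>(j, \<beta>). j # \<beta>) ({..T} \<times> exponents T (length vs))"
    by (auto simp: inj_on_def)
  have "list_poly T (v # vs) c
      = (\<Sum>j\<le>T. \<Sum>\<beta>\<in>exponents T (length vs). c (j # \<beta>) * list_monomial (v # vs) (j # \<beta>))"
    by (simp add: Cons sum_distrib_left algebra_simps)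
  also have "\<dots> = (\<Sum>(j, \<beta>)\<in>{..T} \<times> exponents T (length vs). c (j # \<beta>) * list_monomial (v # vs) (j # \<beta>))"
    by (simp add: sum.cartesian_product)
  also have "\<dots> = (\<Sum>\<beta>\<in>exponents T (length (v # vs)). c \<beta> * list_monomial (v # vs) \<beta>)"
    unfolding list.size(4) add_0_right add_Suc_right One_nat_def exponents_Suc sum.reindex[OF inj]
    by (rule sum.cong) auto
  finally show ?case .
qed simp

lemma list_poly_zero: "(\<And>\<beta>. \<beta> \<in> exponents T (length vs) \<Longrightarrow> c \<beta> = 0) \<Longrightarrow> list_poly T vs c = 0"
  by (simp add: list_poly_eq_sum)

lemma list_poly_append:
  "list_poly T (us @ vs) c = list_poly T us (\<lambda>\<alpha>. list_poly T vs (\<lambda>\<beta>. c (\<alpha> @ \<beta>)))"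
  by (induction us arbitrary: c) auto

lemma list_monomial_replicate_0 [simp]: "list_monomial vs (replicate r 0) = 1"
proof (induction vs arbitrary: r)
  case (Cons v vs)
  then show ?case by (cases r) auto
qed simp

lemma list_monomial_increment:
  assumes "length \<beta> = length vs" "i < length vs"
  shows "list_monomial vs (\<beta>[i := Suc (\<beta> ! i)]) = vs ! i * list_monomial vs \<beta>"
  using assms
proof (induction vs \<beta> arbitrary: i rule: list_monomial.induct)
  case (1 v vs b bs)
  then show ?case by (cases i) (auto simp: algebra_simps)
qed auto

lemma list_monomial_in_polys:
  assumes "\<And>f. f \<in> set fs \<Longrightarrow> f \<in> polys D" "\<beta> \<in> exponents T (length fs)"
  shows "(\<lambda>x. list_monomial (map (\<lambda>f. f x) fs) \<beta>) \<in> polys (length fs * (T * D))"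
  using assms
proof (induction fs arbitrary: \<beta>)
  case Nil
  then show ?case by (simp add: polys_const)
next
  case (Cons f fs)
  obtain b \<beta>' where \<beta>: "\<beta> = b # \<beta>'" "b \<le> T" "\<beta>' \<in> exponents T (length fs)"
    using Cons.prems(2) by (auto simp: exponents_Suc)
  have "(\<lambda>x. f x ^ k) \<in> polys (k * D)" for k
  proof (induction k)
    case (Suc k)
    have "(\<lambda>x. f x * f x ^ k) \<in> polys (D + k * D)"
      using Cons.prems(1) Suc by (intro polys_mult) auto
    then show ?case by simp
  qed (simp add: polys_const)
  then have "(\<lambda>x. f x ^ b) \<in> polys (T * D)"
    using polys_mono[of "b * D" "T * D"] \<beta>(2) by auto
  then have "(\<lambda>x. f x ^ b * list_monomial (map (\<lambda>f. f x) fs) \<beta>') \<in> polys (T * D + length fs * (T * D))"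
    using Cons \<beta> by (intro polys_mult) auto
  then show ?case by (simp add: \<beta>)
qed

subsection \<open>Cones cut out to the origin by linear forms\<close>

definition lform :: "complex ^ 'n \<Rightarrow> complex ^ 'n::finite \<Rightarrow> complex" where
  "lform a x = (\<Sum>i\<in>UNIV. a $ i * x $ i)"

definition closed_cone :: "(complex ^ 'n::finite) set \<Rightarrow> bool" where
  "closed_cone X \<longleftrightarrow> algebraic_set X \<and> (\<forall>x\<in>X. \<forall>c. c *s x \<in> X)"

definition cuts_to_origin :: "(complex ^ 'n) list \<Rightarrow> (complex ^ 'n::finite) set \<Rightarrow> bool" where
  "cuts_to_origin as X \<longleftrightarrow> (\<forall>x\<in>X. (\<forall>a\<in>set as. lform a x = 0) \<longrightarrow> x = 0)"

lemma lform_in_polys: "lform a \<in> polys 1"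
proof -
  have "(\<lambda>x. \<Sum>i\<in>UNIV. a $ i * x $ i) \<in> polys 1"
    by (intro polys_sum polys_cmult polys_coord) simp
  then show ?thesis by (simp add: lform_def[abs_def])
qed

lemma lform_in_polyfuns: "lform a \<in> polyfuns"
  using lform_in_polys by (auto simp: polyfuns_def)

lemma lform_scale: "lform a (c *s x) = c * lform a x"
  by (simp add: lform_def sum_distrib_left algebra_simps)

text \<open>
  Clearing denominators in \<open>h (x / x\<^sub>j)\<close> is homogenization with respect to the variable \<open>x\<^sub>j\<close>.
\<close>

lemma polys_homogenize:
  assumes "h \<in> polys T"
  shows "\<exists>B\<in>polys T. \<forall>x. x $ j \<noteq> 0 \<longrightarrow> (x $ j) ^ T * h (inverse (x $ j) *s x) = B x"
  using assms
proof (induction rule: polys_induct)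
  case zero
  show ?case by (rule bexI[of _ "\<lambda>x. 0"]) (simp_all add: polys_const)
next
  case (step c M g)
  then obtain B where B: "B \<in> polys T"
    "\<forall>x. x $ j \<noteq> 0 \<longrightarrow> (x $ j) ^ T * g (inverse (x $ j) *s x) = B x"
    by blast
  let ?M = "replicate_mset (T - size M) j + M"
  have "monomial ?M \<in> polys T" using step.hyps by (intro monomial_in_polys) simp
  moreover have "(x $ j) ^ T * monomial M (inverse (x $ j) *s x) = monomial ?M x" if "x $ j \<noteq> 0" for x
    using that step.hyps
    by (simp add: monomial_scale monomial_union monomial_replicate power_diff field_simps)
  ultimately show ?case
    using B by (intro bexI[of _ "\<lambda>x. c * monomial ?M x + B x"])
      (auto simp: algebra_simps intro!: polys_add polys_cmult)
qed

text \<open>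
  On a cone cut to the origin by linear forms, each coordinate is integral over these forms.  The
  functions \<open>lform a\<close> and \<open>x\<^sub>j - 1\<close> have no common zero on \<open>X\<close>, so the Nullstellensatz writes \<open>1\<close> as a
  combination of them.  Evaluating this identity at \<open>x / x\<^sub>j\<close>, which lies in the cone again, removes the
  last term, and homogenization gives a power of \<open>x\<^sub>j\<close>.  For the count below it matters that \<open>B i\<close> has
  smaller degree than the power of \<open>x\<^sub>j\<close>.
\<close>

lemma coordinate_power_on_cone:
  assumes X: "closed_cone X" and cut: "cuts_to_origin as X"
  shows "\<exists>T. \<forall>t\<ge>T. \<exists>B. (\<forall>i<length as. B i \<in> polys t) \<and>
           (\<forall>x\<in>X. (x $ j) ^ Suc t = (\<Sum>i<length as. lform (as ! i) x * B i x))"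
proof -
  let ?m = "length as"
  define g where "g i = (if i < ?m then lform (as ! i) else (\<lambda>x. x $ j - 1))" for i
  have "\<exists>i<Suc ?m. g i x \<noteq> 0" if x: "x \<in> X" for x
  proof (cases "x = 0")
    case True
    then show ?thesis by (intro exI[of _ ?m]) (simp add: g_def)
  next
    case False
    then obtain a where "a \<in> set as" "lform a x \<noteq> 0"
      using cut x by (auto simp: cuts_to_origin_def)
    then obtain i where "i < ?m" "lform (as ! i) x \<noteq> 0" by (metis in_set_conv_nth)
    then show ?thesis by (intro exI[of _ i]) (simp add: g_def)
  qed
  moreover have "g i \<in> polyfuns" for i
    by (auto simp: g_def lform_in_polyfuns intro!: polyfuns_intros)
  ultimately obtain h where h: "\<forall>i<Suc ?m. h i \<in> polyfuns" "\<forall>x\<in>X. (\<Sum>i<Suc ?m. g i x * h i x) = 1"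
    using nullstellensatz_on_algebraic_set[of X "Suc ?m" g] X by (auto simp: closed_cone_def)
  have "\<forall>i. \<exists>t. i < ?m \<longrightarrow> h i \<in> polys t" using h(1) by (auto simp: polyfuns_def less_Suc_eq)
  then obtain d where d: "\<And>i. i < ?m \<Longrightarrow> h i \<in> polys (d i)" by metis
  define T where "T = (\<Sum>i<?m. d i)"
  have "h i \<in> polys T" if "i < ?m" for i
    using d[OF that] polys_mono[of "d i" T] that member_le_sum[of i "{..<?m}" d] by (auto simp: T_def)
  then have "\<forall>i. \<exists>B. i < ?m \<longrightarrow> B \<in> polys T \<and>
      (\<forall>x. x $ j \<noteq> 0 \<longrightarrow> (x $ j) ^ T * h i (inverse (x $ j) *s x) = B x)"
    using polys_homogenize by metis
  then obtain B where B: "\<And>i. i < ?m \<Longrightarrow> B i \<in> polys T"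
    "\<And>i x. i < ?m \<Longrightarrow> x $ j \<noteq> 0 \<Longrightarrow> (x $ j) ^ T * h i (inverse (x $ j) *s x) = B i x"
    by metis
  have key: "(x $ j) ^ Suc T = (\<Sum>i<?m. lform (as ! i) x * B i x)" if "x \<in> X" "x $ j \<noteq> 0" for x
  proof -
    define y where "y = inverse (x $ j) *s x"
    have "y \<in> X" using X that(1) by (auto simp: closed_cone_def y_def)
    moreover have "y $ j = 1" using that(2) by (simp add: y_def)
    ultimately have "(\<Sum>i<?m. lform (as ! i) y * h i y) = 1"
      using bspec[OF h(2), of y] by (simp add: g_def)
    then have "(x $ j) ^ Suc T = (x $ j) ^ Suc T * (\<Sum>i<?m. lform (as ! i) y * h i y)" by simp
    also have "\<dots> = (\<Sum>i<?m. lform (as ! i) x * ((x $ j) ^ T * h i y))"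
      unfolding sum_distrib_left
      by (rule sum.cong) (use that(2) in \<open>simp_all add: y_def lform_scale field_simps\<close>)
    also have "\<dots> = (\<Sum>i<?m. lform (as ! i) x * B i x)"
      by (rule sum.cong) (use that(2) B(2) in \<open>auto simp: y_def\<close>)
    finally show ?thesis .
  qed
  show ?thesis
  proof (intro exI[of _ "Suc T"] allI impI)
    fix t assume "Suc T \<le> t"
    then obtain k where t: "t = Suc k + T" by (metis add.commute add_Suc less_eqE add_Suc_right)
    \<comment> \<open>the positive power of \<open>x\<^sub>j\<close> makes the identity true also where \<open>x\<^sub>j = 0\<close>\<close>
    let ?B = "\<lambda>i x. (x $ j) ^ Suc k * B i x"
    have "?B i \<in> polys t" if "i < ?m" for i
    proof -
      have "(\<lambda>x. monomial (replicate_mset (Suc k) j) x * B i x) \<in> polys (Suc k + T)"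
        using polys_mult_mono[OF B(1)[OF that], of "replicate_mset (Suc k) j"] by simp
      then show ?thesis unfolding monomial_replicate t .
    qed
    moreover have "(x $ j) ^ Suc t = (\<Sum>i<?m. lform (as ! i) x * ?B i x)" if "x \<in> X" for x
    proof (cases "x $ j = 0")
      case False
      have "(x $ j) ^ Suc t = (x $ j) ^ Suc k * (\<Sum>i<?m. lform (as ! i) x * B i x)"
        unfolding key[OF that False, symmetric] power_add[symmetric] by (simp add: t)
      then show ?thesis by (simp only: sum_distrib_left mult.left_commute)
    qed simp
    ultimately show "\<exists>B. (\<forall>i<?m. B i \<in> polys t) \<and>
        (\<forall>x\<in>X. (x $ j) ^ Suc t = (\<Sum>i<?m. lform (as ! i) x * B i x))"
      by (intro exI[of _ ?B]) blast
  qed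
qed

lemma large_multiset_has_repetition:
  assumes "CARD('n::finite) * t < size (M :: 'n multiset)"
  obtains j M' where "M = replicate_mset (Suc t) j + M'"
proof -
  have "\<exists>j. t < count M j"
  proof (rule ccontr)
    assume "\<not> ?thesis"
    then have "\<And>j. count M j \<le> t" by (simp add: not_less)
    then have "(\<Sum>j\<in>UNIV. count M j) \<le> CARD('n) * t"
      using sum_bounded_above[of "UNIV :: 'n set" "count M" t] by simp
    moreover have "size M = (\<Sum>j\<in>UNIV. count M j)"
      unfolding size_multiset_overloaded_eq by (rule sum.mono_neutral_left) (auto simp: not_in_iff)
    ultimately show False using assms by simp
  qed
  then obtain j where "replicate_mset (Suc t) j \<subseteq># M"
    by (metis Suc_leI count_le_replicate_mset_subset_eq)
  then show ?thesis using that by (metis subset_mset.add_diff_inverse)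
qed

text \<open>
  On such a cone the polynomial functions form a finitely generated module over the polynomials in
  the \<open>m\<close> linear forms, with the monomials in \<open>E\<close> as generators, and a function of degree \<open>T\<close> needs only
  exponents up to \<open>T\<close>.  A monomial of large degree contains a high power of some coordinate, which
  the preceding lemma trades for linear forms times functions of lower degree.  Hence the functions
  of degree at most \<open>T\<close> restrict to a space whose dimension grows at most like \<open>T\<close> to the power \<open>m\<close>.
\<close>

lemma polys_on_cone_spanned:
  fixes X :: "(complex ^ 'n::finite) set"
  assumes X: "closed_cone X" and cut: "cuts_to_origin as X"
  shows "\<exists>E. finite E \<and> (\<forall>T. \<forall>f\<in>polys T. \<exists>g\<in>FV.span ((\<lambda>(M, \<beta>) x. monomial M x *
            list_monomial (map (\<lambda>a. lform a x) as) \<beta>) ` (E \<times> exponents T (length as))). \<forall>x\<in>X. f x = g x)"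
proof -
  let ?m = "length as"
  obtain T where T: "\<And>j t. T j \<le> t \<Longrightarrow> \<exists>B. (\<forall>i<?m. B i \<in> polys t) \<and>
      (\<forall>x\<in>X. (x $ j) ^ Suc t = (\<Sum>i<?m. lform (as ! i) x * B i x))"
    using coordinate_power_on_cone[OF X cut] by metis
  define t where "t = (\<Sum>j\<in>UNIV. T j)"
  have "T j \<le> t" for j unfolding t_def by (rule member_le_sum) auto
  then have "\<forall>j. \<exists>B. (\<forall>i<?m. B i \<in> polys t) \<and>
      (\<forall>x\<in>X. (x $ j) ^ Suc t = (\<Sum>i<?m. lform (as ! i) x * B i x))"
    using T by blast
  then obtain B where B: "\<And>j i. i < ?m \<Longrightarrow> B j i \<in> polys t"
    "\<And>j x. x \<in> X \<Longrightarrow> (x $ j) ^ Suc t = (\<Sum>i<?m. lform (as ! i) x * B j i x)"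
    by metis
  define E where "E = {M :: 'n multiset. size M \<le> CARD('n) * t}"
  define w where "w = (\<lambda>(M, \<beta>) x. monomial M x * list_monomial (map (\<lambda>a. lform a x) as) \<beta>)"
  define V where "V T = FV.span (w ` (E \<times> exponents T ?m))" for T
  have V_mono: "V s \<subseteq> V T" if "s \<le> T" for s T
    unfolding V_def using that by (intro FV.span_mono image_mono Sigma_mono exponents_mono) simp
  have V_lform: "(\<lambda>x. lform (as ! i) x * g x) \<in> V (Suc T)" if "g \<in> V T" "i < ?m" for g T i
    using that(1) unfolding V_def
  proof (induction rule: FV.span_induct_alt)
    case base
    then show ?case using FV.span_zero by (simp add: zero_fun_def)
  next
    case (step c u h)
    then obtain M \<beta> where M: "M \<in> E" "\<beta> \<in> exponents T ?m" "u = w (M, \<beta>)" by auto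
    let ?\<beta> = "\<beta>[i := Suc (\<beta> ! i)]"
    have "?\<beta> \<in> exponents (Suc T) ?m"
    proof -
      have \<beta>: "length \<beta> = ?m" "set \<beta> \<subseteq> {..T}" using M(2) by (simp_all add: exponents_def)
      then have "\<beta> ! i \<in> {..T}" using \<open>i < ?m\<close> by (metis nth_mem subsetD)
      then have "insert (Suc (\<beta> ! i)) (set \<beta>) \<subseteq> {..Suc T}" using \<beta>(2) by auto
      then have "set ?\<beta> \<subseteq> {..Suc T}" using set_update_subset_insert by (rule subset_trans[rotated])
      then show ?thesis using \<beta>(1) by (simp add: exponents_def)
    qed
    moreover have "lform (as ! i) x * u x = w (M, ?\<beta>) x" for x
      using list_monomial_increment[of \<beta> "map (\<lambda>a. lform a x) as" i] M(2) \<open>i < ?m\<close>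
      by (simp add: M(3) w_def exponents_def)
    then have "(\<lambda>x. lform (as ! i) x * (((\<lambda>x. c * u x) + h) x))
        = (\<lambda>x. c * w (M, ?\<beta>) x) + (\<lambda>x. lform (as ! i) x * h x)"
      by (simp add: fun_eq_iff distrib_left mult.left_commute)
    moreover have "(\<lambda>x. c * w (M, ?\<beta>) x) + (\<lambda>x. lform (as ! i) x * h x)
        \<in> FV.span (w ` (E \<times> exponents (Suc T) ?m))"
      by (intro FV.span_add FV.span_scale step FV.span_base[OF imageI] SigmaI M(1)
          \<open>?\<beta> \<in> exponents (Suc T) ?m\<close>)
    ultimately show ?case by (simp only:)
  qed
  have "\<exists>g\<in>V T. \<forall>x\<in>X. f x = g x" if "f \<in> polys T" for f T
    using that
  proof (induction T arbitrary: f rule: less_induct)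
    case (less T)
    from less.prems show ?case
    proof (induction rule: polys_induct)
      case zero
      show ?case using FV.span_zero by (intro bexI[of _ "\<lambda>x. 0"]) (auto simp: V_def zero_fun_def)
    next
      case (step c M f)
      have "\<exists>g\<in>V T. \<forall>x\<in>X. monomial M x = g x"
      proof (cases "M \<in> E")
        case True
        have "replicate ?m 0 \<in> exponents T ?m" by (auto simp: exponents_def)
        moreover have "monomial M = w (M, replicate ?m 0)" by (simp add: w_def fun_eq_iff)
        ultimately have "monomial M \<in> w ` (E \<times> exponents T ?m)" using True by blast
        then have "monomial M \<in> V T" unfolding V_def by (rule FV.span_base)
        then show ?thesis by (rule bexI[rotated]) simp
      next
        case False
        then have "CARD('n) * t < size M" by (simp add: E_def)
        then obtain j M' where M: "M = replicate_mset (Suc t) j + M'"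
          by (rule large_multiset_has_repetition)
        then have size: "size M = Suc (t + size M')" by simp
        have "\<forall>i. \<exists>g. i < ?m \<longrightarrow> g \<in> V (t + size M') \<and> (\<forall>x\<in>X. B j i x * monomial M' x = g x)"
        proof (intro allI)
          fix i
          show "\<exists>g. i < ?m \<longrightarrow> g \<in> V (t + size M') \<and> (\<forall>x\<in>X. B j i x * monomial M' x = g x)"
          proof (cases "i < ?m")
            case True
            have "(\<lambda>x. B j i x * monomial M' x) \<in> polys (t + size M')"
              using B(1)[OF True] by (intro polys_mult monomial_in_polys) auto
            moreover have "t + size M' < T" using size step.hyps by simp
            ultimately show ?thesis using less.IH by blast
          qed simp
        qed
        then obtain g where g: "\<And>i. i < ?m \<Longrightarrow> g i \<in> V (t + size M')"
          "\<And>i x. i < ?m \<Longrightarrow> x \<in> X \<Longrightarrow> B j i x * monomial M' x = g i x"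
          by metis
        have "(\<lambda>x. lform (as ! i) x * g i x) \<in> V T" if "i < ?m" for i
          using V_lform[OF g(1)[OF that] that] V_mono[of "Suc (t + size M')" T] size step.hyps by auto
        then have "(\<Sum>i<?m. (\<lambda>x. lform (as ! i) x * g i x)) \<in> V T"
          unfolding V_def by (intro FV.span_sum) auto
        moreover have "monomial M x = (\<Sum>i<?m. (\<lambda>x. lform (as ! i) x * g i x)) x" if "x \<in> X" for x
        proof -
          have "monomial M x = (\<Sum>i<?m. lform (as ! i) x * B j i x) * monomial M' x"
            unfolding M monomial_union monomial_replicate B(2)[OF that] ..
          also have "\<dots> = (\<Sum>i<?m. lform (as ! i) x * g i x)"
            unfolding sum_distrib_right
            by (rule sum.cong) (use g(2) that in \<open>auto simp: mult.assoc\<close>)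
          finally show ?thesis by (simp add: sum_fun_apply)
        qed
        ultimately show ?thesis by (intro bexI ballI)
      qed
      then obtain g where g: "g \<in> V T" "\<forall>x\<in>X. monomial M x = g x" by blast
      obtain h where h: "h \<in> V T" "\<forall>x\<in>X. f x = h x" using step by blast
      have "(\<lambda>x. c * g x) + h \<in> V T"
        using g(1) h(1) unfolding V_def by (intro FV.span_add FV.span_scale)
      then show ?case using g(2) h(2) by (intro bexI[of _ "(\<lambda>x. c * g x) + h"]) auto
    qed
  qed
  then show ?thesis
    unfolding V_def w_def
    by (intro exI[of _ E] conjI allI ballI) (simp_all add: E_def finite_bounded_multisets)
qed

definition alg_indep :: "'a set \<Rightarrow> ('a \<Rightarrow> complex) list \<Rightarrow> bool" where
  "alg_indep X fs \<longleftrightarrow> (\<forall>T c. (\<forall>x\<in>X. list_poly T (map (\<lambda>f. f x) fs) c = 0) \<longrightarrow>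
     (\<forall>\<beta>\<in>exponents T (length fs). c \<beta> = 0))"

text \<open>
  A growth argument, with \<open>m\<close> linear forms \<open>as\<close>: the monomials in \<open>r\<close> functions of degree at most \<open>D\<close> with exponents up to \<open>T\<close> have degree
  at most \<open>r * T * D\<close>.  There are \<open>(T + 1) ^ r\<close> of them, but their restrictions to \<open>X\<close> span a space of dimension
  at most a constant times \<open>(T + 1) ^ m\<close>.  For \<open>r > m\<close> and large \<open>T\<close> they are linearly dependent.
\<close>

theorem alg_indep_length_le:
  fixes X :: "(complex ^ 'n::finite) set"
  assumes X: "closed_cone X" and cut: "cuts_to_origin as X"
    and fs: "set fs \<subseteq> polyfuns" and indep: "alg_indep X fs"
  shows "length fs \<le> length as"
proof (rule ccontr)
  let ?m = "length as" and ?r = "length fs"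
  assume "\<not> ?r \<le> ?m"
  define w where "w = (\<lambda>(M, \<beta>) x. monomial M x * list_monomial (map (\<lambda>a. lform a x) as) \<beta>)"
  obtain E where E: "finite E" and span: "\<forall>T. \<forall>f\<in>polys T. \<exists>g\<in>FV.span (w ` (E \<times> exponents T ?m)). \<forall>x\<in>X. f x = g x"
    using polys_on_cone_spanned[OF X cut] unfolding w_def by (elim exE conjE)
  obtain D where D: "\<And>f. f \<in> set fs \<Longrightarrow> f \<in> polys D"
  proof -
    have "\<exists>D. \<forall>f\<in>set fs. f \<in> polys D"
      using fs
    proof (induction fs)
      case (Cons f fs)
      then obtain D t where "\<forall>f\<in>set fs. f \<in> polys D" "f \<in> polys t" by (auto simp: polyfuns_def)
      then have "\<forall>g\<in>set (f # fs). g \<in> polys (D + t)"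
        using polys_mono[of D "D + t"] polys_mono[of t "D + t"] by auto
      then show ?case by blast
    qed simp
    then show ?thesis using that by blast
  qed
  \<comment> \<open>just large enough for \<open>card W \<le> T * (T + 1) ^ m < (T + 1) ^ (m + 1)\<close>\<close>
  define T where "T = card E * (?r * D + 1) ^ ?m"
  define t where "t = ?r * (T * D)"
  define W where "W = w ` (E \<times> exponents t ?m)"
  have "finite W" using E by (simp add: W_def)
  have "card W \<le> card (E \<times> exponents t ?m)" unfolding W_def by (rule card_image_le) (use E in simp)
  also have "\<dots> = card E * (t + 1) ^ ?m" by (simp add: card_cartesian_product card_exponents)
  also have "\<dots> \<le> card E * ((?r * D + 1) * (T + 1)) ^ ?m"
    by (intro mult_left_mono power_mono) (auto simp: t_def algebra_simps)
  also have "\<dots> = T * (T + 1) ^ ?m" by (simp only: T_def power_mult_distrib mult.assoc)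
  also have "\<dots> < (T + 1) ^ Suc ?m" by simp
  also have "\<dots> \<le> (T + 1) ^ ?r" using \<open>\<not> ?r \<le> ?m\<close> by (intro power_increasing) auto
  finally have card: "card W < card (exponents T ?r)" by (simp add: card_exponents)
  have "\<forall>\<beta>\<in>exponents T ?r. \<exists>g. g \<in> FV.span W \<and> (\<forall>x\<in>X. list_monomial (map (\<lambda>f. f x) fs) \<beta> = g x)"
  proof
    fix \<beta> assume "\<beta> \<in> exponents T ?r"
    then have "(\<lambda>x. list_monomial (map (\<lambda>f. f x) fs) \<beta>) \<in> polys t"
      unfolding t_def using D by (rule list_monomial_in_polys[rotated])
    from span[rule_format, OF this] show "\<exists>g. g \<in> FV.span W \<and> (\<forall>x\<in>X. list_monomial (map (\<lambda>f. f x) fs) \<beta> = g x)"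
      unfolding W_def Bex_def .
  qed
  from bchoice[OF this] obtain g where gW: "\<forall>\<beta>\<in>exponents T ?r. g \<beta> \<in> FV.span W \<and>
      (\<forall>x\<in>X. list_monomial (map (\<lambda>f. f x) fs) \<beta> = g \<beta> x)"
    by (elim exE)
  then have g: "\<And>\<beta>. \<beta> \<in> exponents T ?r \<Longrightarrow> g \<beta> \<in> FV.span W"
    "\<And>\<beta> x. \<beta> \<in> exponents T ?r \<Longrightarrow> x \<in> X \<Longrightarrow> list_monomial (map (\<lambda>f. f x) fs) \<beta> = g \<beta> x"
    by simp_all
  obtain c where c: "\<exists>\<beta>\<in>exponents T ?r. c \<beta> \<noteq> 0" "(\<Sum>\<beta>\<in>exponents T ?r. (\<lambda>x. c \<beta> * g \<beta> x)) = 0"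
  proof -
    have "\<exists>c. (\<exists>\<beta>\<in>exponents T ?r. c \<beta> \<noteq> 0) \<and> (\<Sum>\<beta>\<in>exponents T ?r. (\<lambda>x. c \<beta> * g \<beta> x)) = 0"
      by (rule FV.family_dependent[OF finite_exponents \<open>finite W\<close> card]) (rule g(1))
    then show ?thesis using that by (elim exE conjE)
  qed
  have "list_poly T (map (\<lambda>f. f x) fs) c = 0" if "x \<in> X" for x
  proof -
    have "list_poly T (map (\<lambda>f. f x) fs) c = (\<Sum>\<beta>\<in>exponents T ?r. c \<beta> * g \<beta> x)"
      using g(2) that by (simp add: list_poly_eq_sum)
    also have "\<dots> = 0" using fun_cong[OF c(2), of x] by (simp add: sum_fun_apply)
    finally show ?thesis .
  qed
  then have "\<forall>\<beta>\<in>exponents T ?r. c \<beta> = 0"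
    using indep[unfolded alg_indep_def, rule_format, of T c] by simp
  then show False using c(1) by simp
qed

section \<open>Chains of irreducible sets and algebraic independence\<close>

lemma list_poly_in_polyfuns:
  "set fs \<subseteq> polyfuns \<Longrightarrow> (\<lambda>x. list_poly T (map (\<lambda>f. f x) fs) c) \<in> polyfuns"
  by (induction fs arbitrary: c) (auto intro!: polyfuns_intros)

lemma irreducible_mult_zero:
  assumes Z: "irreducible_algebraic_set Z" and f: "f \<in> polyfuns" and g: "g \<in> polyfuns"
    and fg: "\<And>x. x \<in> Z \<Longrightarrow> f x * g x = 0"
  shows "(\<forall>x\<in>Z. f x = 0) \<or> (\<forall>x\<in>Z. g x = 0)"
proof -
  let ?A = "Z \<inter> {x. f x = 0}" and ?B = "Z \<inter> {x. g x = 0}"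
  have "algebraic_set ?A" "algebraic_set ?B"
    using Z f g by (auto simp: irreducible_algebraic_set_def intro!: algebraic_set_Int algebraic_set_zero_locus)
  moreover have "Z = ?A \<union> ?B" using fg by auto
  ultimately have "Z = ?A \<or> Z = ?B"
    using Z unfolding irreducible_algebraic_set_def by blast
  then show ?thesis by auto
qed

lemma irreducible_power_mult_zero:
  assumes Z: "irreducible_algebraic_set Z" and f: "f \<in> polyfuns" and g: "g \<in> polyfuns"
    and nz: "y \<in> Z" "f y \<noteq> 0" and fg: "\<And>x. x \<in> Z \<Longrightarrow> f x ^ k * g x = 0" and "x \<in> Z"
  shows "g x = 0"
  using irreducible_mult_zero[OF Z polyfuns_power[OF f, of k] g fg] nz \<open>x \<in> Z\<close> by auto

text \<open>
  Given a polynomial relation on \<open>Z\<close>, arranged by powers of \<open>f\<close>, cancel the lowest power of \<open>f\<close> that occurs;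
  this is possible since \<open>Z\<close> is irreducible and \<open>f\<close> is not zero on \<open>Z\<close>.  On \<open>Y\<close>, where \<open>f\<close> vanishes, only
  the lowest coefficient survives, and it is a relation between the functions \<open>fs\<close>.
\<close>

lemma alg_indep_Cons:
  assumes Z: "irreducible_algebraic_set Z" and "Y \<subseteq> Z"
    and f: "f \<in> polyfuns" "\<And>y. y \<in> Y \<Longrightarrow> f y = 0" "z \<in> Z" "f z \<noteq> 0"
    and fs: "set fs \<subseteq> polyfuns" "alg_indep Y fs"
  shows "alg_indep Z (f # fs)"
  unfolding alg_indep_def
proof (intro allI impI ballI)
  fix T c \<beta>
  assume zero: "\<forall>x\<in>Z. list_poly T (map (\<lambda>f. f x) (f # fs)) c = 0"
  define P where "P j x = list_poly T (map (\<lambda>f. f x) fs) (\<lambda>\<beta>. c (j # \<beta>))" for j x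
  have P: "P j \<in> polyfuns" for j
    unfolding P_def[abs_def] by (rule list_poly_in_polyfuns[OF fs(1)])
  have coeffs: "\<forall>\<beta>\<in>exponents T (length fs). c (j # \<beta>) = 0" if "j \<le> T" for j
    using that
  proof (induction j rule: less_induct)
    case (less j)
    define Q where "Q x = (\<Sum>i\<in>{j..T}. f x ^ (i - j) * P i x)" for x
    have Q: "Q \<in> polyfuns"
      unfolding Q_def[abs_def] by (intro polyfuns_intros f P)
    have "f x ^ j * Q x = 0" if "x \<in> Z" for x
    proof -
      have "P i x = 0" if "i < j" for i
        unfolding P_def using less that by (intro list_poly_zero) auto
      then have "(\<Sum>i\<le>T. f x ^ i * P i x) = (\<Sum>i\<in>{j..T}. f x ^ i * P i x)"
        by (intro sum.mono_neutral_right) (auto simp: not_le)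
      also have "\<dots> = f x ^ j * Q x"
        unfolding Q_def sum_distrib_left
        by (rule sum.cong) (auto simp: mult.assoc[symmetric] power_add[symmetric])
      finally show ?thesis using zero that by (simp add: P_def)
    qed
    then have Q0: "Q x = 0" if "x \<in> Z" for x
      using irreducible_power_mult_zero[OF Z f(1) Q f(3,4) _ that] by blast
    have "P j x = 0" if "x \<in> Y" for x
    proof -
      have "Q x = (\<Sum>i\<in>{j}. f x ^ (i - j) * P i x)"
        unfolding Q_def
        by (rule sum.mono_neutral_right) (use less.prems f(2)[OF that] in auto)
      then show ?thesis using Q0 that \<open>Y \<subseteq> Z\<close> by auto
    qed
    then show ?case using fs(2) unfolding alg_indep_def P_def by blast
  qed
  assume "\<beta> \<in> exponents T (length (f # fs))"
  then show "c \<beta> = 0" using coeffs by (auto simp: exponents_Suc)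
qed

lemma alg_indep_mono: "alg_indep X fs \<Longrightarrow> X \<subseteq> Y \<Longrightarrow> alg_indep Y fs"
  unfolding alg_indep_def by (meson subsetD)

definition irreducible_chain :: "nat \<Rightarrow> (complex ^ 'n::finite) set \<Rightarrow> bool" where
  "irreducible_chain k X \<longleftrightarrow> (\<exists>Z. (\<forall>i\<le>k. irreducible_algebraic_set (Z i) \<and> Z i \<subseteq> X) \<and>
     (\<forall>i<k. Z i \<subset> Z (Suc i)))"

text \<open>
  Each strict inclusion of the chain contributes a function that vanishes on the smaller set but
  not on the larger one.
\<close>

theorem irreducible_chain_imp_alg_indep:
  assumes "irreducible_chain k X"
  obtains fs where "length fs = k" "set fs \<subseteq> polyfuns" "alg_indep X fs"
proof -
  obtain Z where Z: "\<And>i. i \<le> k \<Longrightarrow> irreducible_algebraic_set (Z i)" "\<And>i. i \<le> k \<Longrightarrow> Z i \<subseteq> X"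
    "\<And>i. i < k \<Longrightarrow> Z i \<subset> Z (Suc i)"
    using assms by (auto simp: irreducible_chain_def)
  have "\<exists>fs. length fs = i \<and> set fs \<subseteq> polyfuns \<and> alg_indep (Z i) fs" if "i \<le> k" for i
    using that
  proof (induction i)
    case 0
    have "Z 0 \<noteq> {}" using Z(1)[of 0] by (simp add: irreducible_algebraic_set_def)
    then have "alg_indep (Z 0) []" by (auto simp: alg_indep_def)
    then show ?case by (intro exI[of _ "[]"]) simp
  next
    case (Suc i)
    then obtain fs where fs: "length fs = i" "set fs \<subseteq> polyfuns" "alg_indep (Z i) fs" by auto
    have "algebraic_set (Z i)" using Z(1)[of i] Suc.prems by (simp add: irreducible_algebraic_set_def)
    then obtain F where F: "F \<subseteq> polyfuns" "Z i = {x. \<forall>f\<in>F. f x = 0}" by (elim algebraic_setE)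
    obtain z where z: "z \<in> Z (Suc i)" "z \<notin> Z i" using Z(3)[of i] Suc.prems by auto
    then obtain f where f: "f \<in> F" "f z \<noteq> 0" using F(2) by auto
    have "alg_indep (Z (Suc i)) (f # fs)"
    proof (rule alg_indep_Cons)
      show "irreducible_algebraic_set (Z (Suc i))" using Z(1) Suc.prems by blast
      show "Z i \<subseteq> Z (Suc i)" using Z(3)[of i] Suc.prems by auto
      show "f \<in> polyfuns" using f F by auto
      show "f y = 0" if "y \<in> Z i" for y using that f(1) F(2) by auto
    qed (use z f fs in auto)
    then show ?case using fs f(1) F(1) by (intro exI[of _ "f # fs"]) auto
  qed
  from this[of k] obtain fs where "length fs = k" "set fs \<subseteq> polyfuns" "alg_indep (Z k) fs" by auto
  then show ?thesis using that alg_indep_mono[OF _ Z(2)[of k]] by blast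
qed

section \<open>Products and intersections of cones\<close>

definition fst_vec :: "'a ^ ('m::finite + 'n::finite) \<Rightarrow> 'a ^ 'm" where
  "fst_vec z = (\<chi> i. z $ Inl i)"

definition snd_vec :: "'a ^ ('m::finite + 'n::finite) \<Rightarrow> 'a ^ 'n" where
  "snd_vec z = (\<chi> i. z $ Inr i)"

definition pair_vec :: "'a ^ 'm::finite \<Rightarrow> 'a ^ 'n::finite \<Rightarrow> 'a ^ ('m + 'n)" where
  "pair_vec x y = (\<chi> s. case s of Inl i \<Rightarrow> x $ i | Inr j \<Rightarrow> y $ j)"

lemma fst_vec_pair [simp]: "fst_vec (pair_vec x y) = x"
  and snd_vec_pair [simp]: "snd_vec (pair_vec x y) = y"
  by (simp_all add: fst_vec_def snd_vec_def pair_vec_def vec_eq_iff)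

definition prod_vec :: "('a ^ 'm::finite) set \<Rightarrow> ('a ^ 'n::finite) set \<Rightarrow> ('a ^ ('m + 'n)) set" where
  "prod_vec X Y = {z. fst_vec z \<in> X \<and> snd_vec z \<in> Y}"

lemma fst_vec_coord_polyfuns: "(\<lambda>z :: complex ^ ('m::finite + 'n::finite). fst_vec z $ i) \<in> polyfuns"
  and snd_vec_coord_polyfuns: "(\<lambda>z :: complex ^ ('m::finite + 'n::finite). snd_vec z $ j) \<in> polyfuns"
  by (simp_all add: fst_vec_def snd_vec_def polyfuns_coord)

lemma closed_cone_prod_vec:
  fixes X :: "(complex ^ 'm::finite) set" and Y :: "(complex ^ 'n::finite) set"
  assumes "closed_cone X" "closed_cone Y"
  shows "closed_cone (prod_vec X Y)"
proof -
  have "algebraic_set {z :: complex ^ ('m + 'n). fst_vec z \<in> X}"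
    "algebraic_set {z :: complex ^ ('m + 'n). snd_vec z \<in> Y}"
    using assms unfolding closed_cone_def
    by (auto intro: algebraic_set_preimage[OF _ fst_vec_coord_polyfuns]
        algebraic_set_preimage[OF _ snd_vec_coord_polyfuns])
  then have "algebraic_set (prod_vec X Y)"
    unfolding prod_vec_def Collect_conj_eq by (rule algebraic_set_Int)
  moreover have "fst_vec (c *s z) = c *s fst_vec z" "snd_vec (c *s z) = c *s snd_vec z"
    for c and z :: "complex ^ ('m + 'n)"
    by (simp_all add: fst_vec_def snd_vec_def vec_eq_iff)
  ultimately show ?thesis using assms by (auto simp: closed_cone_def prod_vec_def)
qed

text \<open>
  For fixed \<open>y\<close>, a relation on the product is a relation between the functions \<open>fs\<close> on \<open>X\<close>, whose
  coefficients are polynomials in the values of \<open>gs\<close> at \<open>y\<close>.  They vanish, for every \<open>y\<close>.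
\<close>

lemma alg_indep_prod_vec:
  fixes X :: "(complex ^ 'm::finite) set" and Y :: "(complex ^ 'n::finite) set"
  assumes X: "alg_indep X fs" and Y: "alg_indep Y gs"
  shows "alg_indep (prod_vec X Y) (map (\<lambda>f z. f (fst_vec z)) fs @ map (\<lambda>g z. g (snd_vec z)) gs)"
  unfolding alg_indep_def
proof (intro allI impI ballI)
  fix T c \<gamma>
  assume zero: "\<forall>z\<in>prod_vec X Y. list_poly T (map (\<lambda>f. f z)
      (map (\<lambda>f z. f (fst_vec z)) fs @ map (\<lambda>g z. g (snd_vec z)) gs)) c = 0"
  assume "\<gamma> \<in> exponents T (length (map (\<lambda>f z. f (fst_vec z)) fs @ map (\<lambda>g z. g (snd_vec z)) gs))"
  then have "\<gamma> \<in> exponents T (length fs + length gs)" by simp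
  then obtain \<alpha> \<beta> where \<gamma>: "\<gamma> = \<alpha> @ \<beta>" "\<alpha> \<in> exponents T (length fs)" "\<beta> \<in> exponents T (length gs)"
    by (rule exponents_append_split)
  have "list_poly T (map (\<lambda>g. g y) gs) (\<lambda>\<beta>. c (\<alpha> @ \<beta>)) = 0" if "y \<in> Y" for y
  proof -
    have "list_poly T (map (\<lambda>f. f x) fs) (\<lambda>\<alpha>. list_poly T (map (\<lambda>g. g y) gs) (\<lambda>\<beta>. c (\<alpha> @ \<beta>))) = 0"
      if "x \<in> X" for x
      using bspec[OF zero, of "pair_vec x y"] that \<open>y \<in> Y\<close>
      by (simp add: prod_vec_def list_poly_append o_def)
    then show ?thesis
      using X[unfolded alg_indep_def, rule_format,
          of T "\<lambda>\<alpha>. list_poly T (map (\<lambda>g. g y) gs) (\<lambda>\<beta>. c (\<alpha> @ \<beta>))" \<alpha>] \<gamma>(2)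
      by simp
  qed
  then show "c \<gamma> = 0"
    using Y[unfolded alg_indep_def, rule_format, of T "\<lambda>\<beta>. c (\<alpha> @ \<beta>)" \<beta>] \<gamma> by simp
qed

lemma lform_axis: "lform (axis i 1) x = x $ i"
proof -
  have "lform (axis i 1) x = (\<Sum>j\<in>UNIV. if j = i then x $ j else 0)"
    unfolding lform_def by (rule sum.cong) (auto simp: axis_def)
  then show ?thesis by simp
qed

lemma lform_pair_vec:
  fixes a :: "complex ^ 'a::finite" and b :: "complex ^ 'b::finite"
  shows "lform (pair_vec a b) z = lform a (fst_vec z) + lform b (snd_vec z)"
proof -
  have "lform (pair_vec a b) z
      = (\<Sum>s\<in>(UNIV :: 'a set) <+> (UNIV :: 'b set). pair_vec a b $ s * z $ s)"
    by (simp add: lform_def UNIV_Plus_UNIV)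
  also have "\<dots> = lform a (fst_vec z) + lform b (snd_vec z)"
    by (subst sum.Plus) (simp_all add: lform_def fst_vec_def snd_vec_def pair_vec_def)
  finally show ?thesis .
qed

lemma lform_simps:
  "lform 0 x = 0" "lform (- a) x = - lform a x" "lform (a - b) x = lform a x - lform b x"
  "lform (c *s a) x = c * lform a x"
  by (simp_all add: lform_def sum_negf sum_subtractf left_diff_distrib sum_distrib_left mult.assoc)

lemma UNIV_list: obtains xs :: "'n::finite list" where "set xs = UNIV" "length xs = CARD('n)"
proof -
  obtain xs :: "'n list" where "set xs = UNIV" "distinct xs"
    using finite_distinct_list[OF finite_class.finite_UNIV] by blast
  then show ?thesis using that distinct_card[of xs] by simp
qed

lemma cuts_to_origin_subset: "cuts_to_origin as Y \<Longrightarrow> X \<subseteq> Y \<Longrightarrow> cuts_to_origin as X"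
  by (auto simp: cuts_to_origin_def)

lemma coordinate_forms_cut:
  obtains as where "length as = CARD('n::finite)" "cuts_to_origin as (UNIV :: (complex ^ 'n) set)"
proof -
  obtain xs :: "'n list" where xs: "set xs = UNIV" "length xs = CARD('n)" by (rule UNIV_list)
  have "cuts_to_origin (map (\<lambda>i. axis i 1) xs) (UNIV :: (complex ^ 'n) set)"
    using xs(1) by (auto simp: cuts_to_origin_def lform_axis vec_eq_iff)
  then show ?thesis using xs(2) by (intro that[of "map (\<lambda>i. axis i 1) xs"]) simp_all
qed

text \<open>
  Reduction to the diagonal: \<open>X \<inter> Y\<close> is the intersection of the product with the diagonal, which is
  defined by the \<open>CARD('n)\<close> linear forms \<open>x $ i - y $ i\<close>.  Together with the forms \<open>as\<close> these cut the product
  to the origin, while \<open>fs\<close> and \<open>gs\<close> are jointly independent on it.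
\<close>

theorem alg_indep_Int_bound:
  fixes X Y :: "(complex ^ 'n::finite) set"
  assumes X: "closed_cone X" "set fs \<subseteq> polyfuns" "alg_indep X fs"
    and Y: "closed_cone Y" "set gs \<subseteq> polyfuns" "alg_indep Y gs"
    and cut: "cuts_to_origin as (X \<inter> Y)"
  shows "length fs + length gs \<le> length as + CARD('n)"
proof -
  obtain xs :: "'n list" where xs: "set xs = UNIV" "length xs = CARD('n)" by (rule UNIV_list)
  define bs where "bs = map (\<lambda>a. pair_vec a 0) as @ map (\<lambda>i. pair_vec (axis i 1) (- axis i 1)) xs"
  have "cuts_to_origin bs (prod_vec X Y)"
    unfolding cuts_to_origin_def
  proof (intro ballI impI)
    fix z assume z: "z \<in> prod_vec X Y" and zero: "\<forall>b\<in>set bs. lform b z = 0"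
    have "fst_vec z $ i = snd_vec z $ i" for i
      using bspec[OF zero, of "pair_vec (axis i 1) (- axis i 1)"] xs
      by (auto simp: bs_def lform_pair_vec lform_simps lform_axis)
    then have eq: "fst_vec z = snd_vec z" by (simp add: vec_eq_iff)
    have "lform a (fst_vec z) = 0" if "a \<in> set as" for a
      using bspec[OF zero, of "pair_vec a 0"] that by (auto simp: bs_def lform_pair_vec lform_simps)
    moreover have "fst_vec z \<in> X \<inter> Y" using z eq by (auto simp: prod_vec_def)
    ultimately have "fst_vec z = 0" using cut by (auto simp: cuts_to_origin_def)
    then have "z $ s = 0" for s
      using eq by (cases s) (auto simp: fst_vec_def snd_vec_def vec_eq_iff)
    then show "z = 0" by (simp add: vec_eq_iff)
  qed
  then have "length (map (\<lambda>f z. f (fst_vec z)) fs @ map (\<lambda>g z. g (snd_vec z)) gs) \<le> length bs"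
  proof (rule alg_indep_length_le[OF closed_cone_prod_vec[OF X(1) Y(1)]])
    show "set (map (\<lambda>f z. f (fst_vec z)) fs @ map (\<lambda>g z. g (snd_vec z)) gs)
        \<subseteq> (polyfuns :: (complex ^ ('n + 'n) \<Rightarrow> complex) set)"
      using X(2) Y(2) by (auto intro!: polyfuns_compose[OF _ fst_vec_coord_polyfuns]
          polyfuns_compose[OF _ snd_vec_coord_polyfuns])
  qed (rule alg_indep_prod_vec[OF X(3) Y(3)])
  then show ?thesis by (simp add: bs_def xs)
qed

section \<open>Cutting a union of two cones\<close>

lemma list_poly_common_nonzero:
  assumes "\<beta> \<in> exponents T r" "c \<beta> \<noteq> 0" "\<beta>' \<in> exponents T' r" "c' \<beta>' \<noteq> 0"
  shows "\<exists>v. length v = r \<and> 0 \<notin> set v \<and> list_poly T v c \<noteq> 0 \<and> list_poly T' v c' \<noteq> 0"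
  using assms
proof (induction r arbitrary: \<beta> \<beta>' c c')
  case 0
  then show ?case by simp
next
  case (Suc r)
  obtain j \<alpha> where \<beta>: "\<beta> = j # \<alpha>" "j \<le> T" "\<alpha> \<in> exponents T r"
    using Suc.prems(1) by (auto simp: exponents_Suc)
  obtain j' \<alpha>' where \<beta>': "\<beta>' = j' # \<alpha>'" "j' \<le> T'" "\<alpha>' \<in> exponents T' r"
    using Suc.prems(3) by (auto simp: exponents_Suc)
  obtain v where v: "length v = r" "0 \<notin> set v"
    "list_poly T v (\<lambda>\<beta>. c (j # \<beta>)) \<noteq> 0" "list_poly T' v (\<lambda>\<beta>. c' (j' # \<beta>)) \<noteq> 0"
    using Suc.IH[OF \<beta>(3) _ \<beta>'(3), of "\<lambda>\<beta>. c (j # \<beta>)" "\<lambda>\<beta>. c' (j' # \<beta>)"] Suc.prems(2,4) \<beta>(1) \<beta>'(1)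
    by auto
  define p where "p T c = (\<Sum>j\<le>T. monom (list_poly T v (\<lambda>\<beta>. c (j # \<beta>))) j)"
    for T and c :: "nat list \<Rightarrow> complex"
  have "coeff (p T c) j = list_poly T v (\<lambda>\<beta>. c (j # \<beta>))" if "j \<le> T" for T c j
    using that by (simp add: p_def coeff_sum sum.delta)
  then have "p T c \<noteq> 0" "p T' c' \<noteq> 0" using v \<beta>(2) \<beta>'(2) by (metis coeff_0)+
  \<comment> \<open>the last factor keeps the new coordinate \<open>z\<close> away from \<open>0\<close>\<close>
  then have "p T c * p T' c' * [:0, 1:] \<noteq> 0" by simp
  then have "finite {z. poly (p T c * p T' c' * [:0, 1:]) z = 0}" by (rule poly_roots_finite)
  then obtain z where z: "poly (p T c * p T' c' * [:0, 1:]) z \<noteq> 0"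
    using infinite_UNIV_char_0[where 'a = complex] by (metis (mono_tags, lifting) UNIV_eq_I mem_Collect_eq)
  have "poly (p T c) z = list_poly T (z # v) c" for T c
    by (simp add: p_def poly_sum poly_monom mult.commute)
  then show ?case using v z by (intro exI[of _ "z # v"]) auto
qed

text \<open>
  As there are more forms \<open>cs\<close> than are needed to cut \<open>A\<close>, they satisfy a nonzero polynomial relation on \<open>A\<close>,
  and likewise on \<open>B\<close>.  Choose a vector \<open>v\<close> at which neither of the two relations holds.  The forms \<open>ds\<close>
  vanish at \<open>x\<close> exactly if the values of \<open>cs\<close> at \<open>x\<close> are proportional to \<open>v\<close>; for \<open>x\<close> in \<open>A \<union> B\<close> with
  nonzero values, rescaling \<open>x\<close> within its cone would make them equal to \<open>v\<close>, against the choice of \<open>v\<close>.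
\<close>

lemma drop_one_cutting_form:
  fixes A B :: "(complex ^ 'n::finite) set"
  assumes A: "closed_cone A" "cuts_to_origin as A" "length as < length cs"
    and B: "closed_cone B" "cuts_to_origin bs B" "length bs < length cs"
    and cs: "cuts_to_origin cs (A \<union> B)"
  shows "\<exists>ds. Suc (length ds) = length cs \<and> cuts_to_origin ds (A \<union> B)"
proof -
  have dependent: "\<exists>T c. (\<exists>\<beta>\<in>exponents T (length cs). c \<beta> \<noteq> 0) \<and>
      (\<forall>x\<in>X. list_poly T (map (\<lambda>a. lform a x) cs) c = 0)"
    if "closed_cone X" "cuts_to_origin es X" "length es < length cs" for X and es :: "(complex ^ 'n) list"
  proof -
    have "set (map lform cs) \<subseteq> polyfuns" using lform_in_polyfuns by auto
    then have "\<not> alg_indep X (map lform cs)"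
      using alg_indep_length_le[OF that(1,2), of "map lform cs"] that(3) by auto
    then show ?thesis by (simp add: alg_indep_def o_def) blast
  qed
  from dependent[OF A] obtain T c \<beta> where c: "\<beta> \<in> exponents T (length cs)" "c \<beta> \<noteq> 0"
    "\<And>x. x \<in> A \<Longrightarrow> list_poly T (map (\<lambda>a. lform a x) cs) c = 0" by auto
  from dependent[OF B] obtain T' c' \<beta>' where c': "\<beta>' \<in> exponents T' (length cs)" "c' \<beta>' \<noteq> 0"
    "\<And>x. x \<in> B \<Longrightarrow> list_poly T' (map (\<lambda>a. lform a x) cs) c' = 0" by auto
  obtain v where v: "length v = length cs" "0 \<notin> set v" "list_poly T v c \<noteq> 0" "list_poly T' v c' \<noteq> 0"
    using list_poly_common_nonzero[of \<beta> T "length cs" c \<beta>' T' c'] c(1,2) c'(1,2) by blast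
  obtain e es where es: "cs = e # es" using A(3) by (cases cs) auto
  obtain w ws where ws: "v = w # ws" using v(1) es by (cases v) auto
  have "w \<noteq> 0" "length ws = length es" using v(1,2) es ws by auto
  define ds where "ds = map (\<lambda>(a, u). w *s a - u *s e) (zip es ws)"
  have "cuts_to_origin ds (A \<union> B)"
    unfolding cuts_to_origin_def
  proof (intro ballI impI)
    fix x assume x: "x \<in> A \<union> B" and zero: "\<forall>d\<in>set ds. lform d x = 0"
    define k where "k = lform e x / w"
    have proportional: "map (\<lambda>a. lform a x) cs = map (\<lambda>u. k * u) v"
    proof (rule nth_equalityI)
      fix i assume "i < length (map (\<lambda>a. lform a x) cs)"
      then have i: "i < length cs" by simp
      show "map (\<lambda>a. lform a x) cs ! i = map (\<lambda>u. k * u) v ! i"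
      proof (cases i)
        case 0
        then show ?thesis using \<open>w \<noteq> 0\<close> by (simp add: es ws k_def)
      next
        case (Suc l)
        then have l: "l < length es" using i es by simp
        then have "w *s (es ! l) - (ws ! l) *s e \<in> set ds"
          using \<open>length ws = length es\<close> by (force simp: ds_def set_zip)
        then have "w * lform (es ! l) x = ws ! l * lform e x"
          using bspec[OF zero] by (fastforce simp: lform_simps)
        then show ?thesis
          using Suc l \<open>w \<noteq> 0\<close> \<open>length ws = length es\<close> by (simp add: es ws k_def field_simps)
      qed
    qed (simp add: v(1))
    show "x = 0"
    proof (cases "k = 0")
      case True
      have "lform a x = 0" if "a \<in> set cs" for a
      proof -
        have "lform a x \<in> set (map (\<lambda>a. lform a x) cs)" using that by simp
        then show ?thesis unfolding proportional using True by auto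
      qed
      then show ?thesis using cs x by (auto simp: cuts_to_origin_def)
    next
      case False
      let ?y = "inverse k *s x"
      have "map (\<lambda>a. lform a ?y) cs = map (\<lambda>t. inverse k * t) (map (\<lambda>a. lform a x) cs)"
        by (simp add: lform_scale)
      also have "\<dots> = v" unfolding proportional using False by (simp add: o_def mult.assoc[symmetric])
      finally have y: "map (\<lambda>a. lform a ?y) cs = v" .
      have "?y \<in> A \<or> ?y \<in> B" using x A(1) B(1) by (auto simp: closed_cone_def)
      then show ?thesis using c(3)[of ?y] c'(3)[of ?y] v(3,4) unfolding y by auto
    qed
  qed
  moreover have "Suc (length ds) = length cs" using \<open>length ws = length es\<close> by (simp add: ds_def es)
  ultimately show ?thesis by blast
qed

text \<open>
  Linear forms that cut \<open>A\<close> and linear forms that cut \<open>B\<close> need not have anything in common.  The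
  coordinate functions cut both cones, and while there are more than \<open>m\<close> forms, one can be dropped.
\<close>

theorem cuts_to_origin_Un:
  fixes A B :: "(complex ^ 'n::finite) set"
  assumes A: "closed_cone A" "cuts_to_origin as A" "length as \<le> m"
    and B: "closed_cone B" "cuts_to_origin bs B" "length bs \<le> m"
  shows "\<exists>cs. length cs \<le> m \<and> cuts_to_origin cs (A \<union> B)"
proof -
  have "\<exists>ds. length ds \<le> m \<and> cuts_to_origin ds (A \<union> B)" if "cuts_to_origin cs (A \<union> B)" for cs
    using that
  proof (induction "length cs" arbitrary: cs rule: less_induct)
    case less
    show ?case
    proof (cases "length cs \<le> m")
      case False
      then obtain ds where "Suc (length ds) = length cs" "cuts_to_origin ds (A \<union> B)"
        using drop_one_cutting_form[OF A(1,2) _ B(1,2) _ less.prems] A(3) B(3) by auto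
      then show ?thesis using less.hyps[of ds] by auto
    qed (use less.prems in blast)
  qed
  moreover obtain cs where "cuts_to_origin cs (A \<union> B)"
    using coordinate_forms_cut cuts_to_origin_subset by (metis subset_UNIV)
  ultimately show ?thesis by blast
qed

section \<open>Chains of irreducible sets in cones that are hard to cut\<close>

text \<open>
  For closed cones that contain the origin this turns out to say that the dimension is at least
  \<open>k\<close>.  Cones with this property are called hard to cut below.
\<close>

definition min_cut_ge :: "nat \<Rightarrow> (complex ^ 'n::finite) set \<Rightarrow> bool" where
  "min_cut_ge k X \<longleftrightarrow> (\<forall>as. length as < k \<longrightarrow> \<not> cuts_to_origin as X)"

text \<open>
  The largest cone inside an algebraic set.  It serves to replace arbitrary algebraic sets by cones
  when irreducibility is tested.
\<close>

lemma cone_line_closure: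
  fixes A :: "(complex ^ 'n::finite) set"
  assumes "algebraic_set A"
  shows "closed_cone {x. \<forall>c. c *s x \<in> A}"
proof -
  have "(\<lambda>x. (c *s x) $ i) \<in> polyfuns" for c i
    by (simp add: polyfuns_cmult[OF polyfuns_coord])
  then have "algebraic_set {x. c *s x \<in> A}" for c
    by (intro algebraic_set_preimage[OF assms])
  then have "algebraic_set (\<Inter>c. {x. c *s x \<in> A})"
    by (intro algebraic_set_Inter) auto
  moreover have "(\<Inter>c. {x. c *s x \<in> A}) = {x. \<forall>c. c *s x \<in> A}" by auto
  moreover have "c *s (d *s x) = (c * d) *s x" for c d and x :: "complex ^ 'n"
    by (simp add: vector_smult_assoc)
  ultimately show ?thesis by (auto simp: closed_cone_def)
qed

text \<open>
  The line through \<open>x\<close> and the origin cannot be covered by two algebraic sets neither of which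
  contains it, since each of them would meet the line in finitely many multiples of \<open>x\<close>.
\<close>

lemma line_in_union:
  fixes A B :: "(complex ^ 'n::finite) set"
  assumes A: "algebraic_set A" and B: "algebraic_set B" and line: "\<And>c. c *s x \<in> A \<union> B"
  shows "(\<forall>c. c *s x \<in> A) \<or> (\<forall>c. c *s x \<in> B)"
proof (rule ccontr)
  assume "\<not> ?thesis"
  then obtain c d where "c *s x \<notin> A" "d *s x \<notin> B" by blast
  obtain F where F: "F \<subseteq> polyfuns" "A = {x. \<forall>f\<in>F. f x = 0}" using A by (elim algebraic_setE)
  obtain G where G: "G \<subseteq> polyfuns" "B = {x. \<forall>f\<in>G. f x = 0}" using B by (elim algebraic_setE)
  obtain f where f: "f \<in> F" "f (c *s x) \<noteq> 0" using \<open>c *s x \<notin> A\<close> F(2) by auto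
  obtain g where g: "g \<in> G" "g (d *s x) \<noteq> 0" using \<open>d *s x \<notin> B\<close> G(2) by auto
  obtain p where p: "\<And>s. f (s *s x) = poly p s" using polyfuns_on_line[of f x] f(1) F(1) by auto
  obtain q where q: "\<And>s. g (s *s x) = poly q s" using polyfuns_on_line[of g x] g(1) G(1) by auto
  have "p \<noteq> 0" "q \<noteq> 0" using p q f(2) g(2) by auto
  then have "p * q \<noteq> 0" by simp
  then have "finite {s. poly (p * q) s = 0}" by (rule poly_roots_finite)
  then obtain s where "poly (p * q) s \<noteq> 0"
    using infinite_UNIV_char_0[where 'a = complex] by (metis (mono_tags, lifting) UNIV_eq_I mem_Collect_eq)
  then have "f (s *s x) \<noteq> 0" "g (s *s x) \<noteq> 0" using p q by auto
  then have "s *s x \<notin> A" "s *s x \<notin> B" using f(1) g(1) F(2) G(2) by auto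
  then show False using line by blast
qed

text \<open>
  If \<open>Y\<close> is the union of \<open>A\<close> and \<open>B\<close>, then it is also the union of the largest cones inside \<open>A\<close> and \<open>B\<close>,
  because each line in \<open>Y\<close> lies in one of the two sets.  One of these cones must be as hard to cut as
  \<open>Y\<close>, and minimality makes it equal to \<open>Y\<close>.
\<close>

lemma minimal_hard_cone_irreducible:
  fixes Y :: "(complex ^ 'n::finite) set"
  assumes Y: "closed_cone Y" "min_cut_ge (Suc k) Y"
    and minimal: "\<And>X. closed_cone X \<Longrightarrow> X \<subseteq> Y \<Longrightarrow> min_cut_ge (Suc k) X \<Longrightarrow> X = Y"
  shows "irreducible_algebraic_set Y"
  unfolding irreducible_algebraic_set_def
proof (intro conjI allI impI)
  show "algebraic_set Y" using Y(1) by (simp add: closed_cone_def)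
  have "\<not> cuts_to_origin [] Y" using Y(2) by (simp add: min_cut_ge_def)
  then show "Y \<noteq> {}" by (auto simp: cuts_to_origin_def)
  fix A B assume AB: "algebraic_set A \<and> algebraic_set B \<and> Y = A \<union> B"
  define A' where "A' = {x. \<forall>c. c *s x \<in> A}"
  define B' where "B' = {x. \<forall>c. c *s x \<in> B}"
  have cones: "closed_cone A'" "closed_cone B'"
    unfolding A'_def B'_def using AB by (auto intro: cone_line_closure)
  have sub: "A' \<subseteq> A" "B' \<subseteq> B" unfolding A'_def B'_def by (auto dest: spec[of _ 1])
  have "Y \<subseteq> A' \<union> B'"
  proof
    fix x assume "x \<in> Y"
    then have "c *s x \<in> A \<union> B" for c using Y(1) AB by (auto simp: closed_cone_def)
    then show "x \<in> A' \<union> B'" using line_in_union[of A B x] AB by (auto simp: A'_def B'_def)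
  qed
  have "min_cut_ge (Suc k) A' \<or> min_cut_ge (Suc k) B'"
  proof (rule ccontr)
    assume "\<not> ?thesis"
    then obtain as bs where "cuts_to_origin as A'" "length as \<le> k" "cuts_to_origin bs B'" "length bs \<le> k"
      by (auto simp: min_cut_ge_def less_Suc_eq_le)
    then obtain cs where "length cs \<le> k" "cuts_to_origin cs (A' \<union> B')"
      using cuts_to_origin_Un[OF cones(1) _ _ cones(2)] by blast
    then show False
      using Y(2) cuts_to_origin_subset[OF _ \<open>Y \<subseteq> A' \<union> B'\<close>] by (auto simp: min_cut_ge_def less_Suc_eq_le)
  qed
  then have "A' = Y \<or> B' = Y" using minimal cones sub AB by blast
  then show "Y = A \<or> Y = B" using sub AB by blast
qed

text \<open>
  That linear forms do not cut a cone to the origin means that they have a common zero in the cone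
  and on the unit sphere.  By compactness of the sphere this property passes to the intersection
  of a chain of cones.
\<close>

lemma chain_Inter_hard:
  fixes D :: "(complex ^ 'n::finite) set set"
  assumes "D \<noteq> {}" and chain: "\<And>X Y. X \<in> D \<Longrightarrow> Y \<in> D \<Longrightarrow> X \<subseteq> Y \<or> Y \<subseteq> X"
    and D: "\<And>Y. Y \<in> D \<Longrightarrow> closed_cone Y \<and> min_cut_ge k Y"
  shows "min_cut_ge k (\<Inter>D)"
  unfolding min_cut_ge_def
proof (intro allI impI)
  fix as :: "(complex ^ 'n) list"
  assume as: "length as < k"
  define U where "U = sphere 0 1 \<inter> (\<Inter>a\<in>set as. {x :: complex ^ 'n. lform a x = 0})"
  have "closed (\<Inter>a\<in>set as. {x :: complex ^ 'n. lform a x = 0})"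
    by (intro closed_INT ballI closed_algebraic_set algebraic_set_zero_locus lform_in_polyfuns)
  then have "compact U" unfolding U_def by (rule compact_Int_closed[OF compact_sphere])
  have meets: "U \<inter> Y \<noteq> {}" if Y: "Y \<in> D" for Y
  proof -
    obtain x where x: "x \<in> Y" "x \<noteq> 0" "\<forall>a\<in>set as. lform a x = 0"
      using D[OF Y] as by (auto simp: min_cut_ge_def cuts_to_origin_def)
    let ?y = "complex_of_real (inverse (norm x)) *s x"
    have "?y = inverse (norm x) *\<^sub>R x"
      unfolding vec_eq_iff vector_smult_component vector_scaleR_component
      by (simp add: scaleR_conv_of_real)
    then have "norm ?y = 1" using x(2) by simp
    moreover have "?y \<in> Y" using D[OF Y] x(1) by (auto simp: closed_cone_def)
    moreover have "\<forall>a\<in>set as. lform a ?y = 0" using x(3) by (simp add: lform_scale)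
    ultimately show ?thesis unfolding U_def by auto
  qed
  have "U \<inter> \<Inter>D \<noteq> {}"
  proof (rule compact_imp_fip[OF \<open>compact U\<close>])
    show "closed Y" if "Y \<in> D" for Y
      using D[OF that] by (auto simp: closed_cone_def intro: closed_algebraic_set)
    fix F assume F: "finite F" "F \<subseteq> D"
    show "U \<inter> \<Inter>F \<noteq> {}"
    proof (cases "F = {}")
      case True
      then show ?thesis using \<open>D \<noteq> {}\<close> meets by auto
    next
      case False
      have "subset.chain UNIV F" using F(2) chain by (auto simp: subset_chain_def)
      then have "\<Inter>F \<in> D" using Inter_in_chain[OF F(1) False] F(2) by blast
      then show ?thesis by (rule meets)
    qed
  qed
  then obtain x where "norm x = 1" "x \<in> \<Inter>D" "\<forall>a\<in>set as. lform a x = 0"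
    by (auto simp: U_def)
  moreover from this have "x \<noteq> 0" by auto
  ultimately show "\<not> cuts_to_origin as (\<Inter>D)" unfolding cuts_to_origin_def by blast
qed

text \<open>
  Zorn's lemma, applied to complements, since it provides maximal elements.
\<close>

lemma minimal_hard_cone_exists:
  fixes X :: "(complex ^ 'n::finite) set"
  assumes X: "closed_cone X" "min_cut_ge k X"
  obtains Y where "closed_cone Y" "Y \<subseteq> X" "min_cut_ge k Y"
    "\<And>Z. closed_cone Z \<Longrightarrow> Z \<subseteq> Y \<Longrightarrow> min_cut_ge k Z \<Longrightarrow> Z = Y"
proof -
  define C where "C = {W. closed_cone (- W) \<and> - W \<subseteq> X \<and> min_cut_ge k (- W)}"
  have "\<exists>M\<in>C. \<forall>W\<in>C. M \<subseteq> W \<longrightarrow> W = M"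
  proof (rule subset_Zorn_nonempty)
    show "C \<noteq> {}" using X by (auto simp: C_def intro!: exI[of _ "- X"])
    fix E assume E: "E \<noteq> {}" "subset.chain C E"
    define D where "D = uminus ` E"
    have D: "closed_cone Y \<and> min_cut_ge k Y" "Y \<subseteq> X" if "Y \<in> D" for Y
      using that E(2) by (auto simp: D_def C_def subset_chain_def)
    have chain: "Y \<subseteq> Z \<or> Z \<subseteq> Y" if "Y \<in> D" "Z \<in> D" for Y Z
      using that E(2) unfolding D_def subset_chain_def by blast
    have "D \<noteq> {}" using E(1) by (simp add: D_def)
    have eq: "- \<Union>E = \<Inter>D" by (auto simp: D_def)
    have "closed_cone (\<Inter>D)"
      using D(1) by (auto simp: closed_cone_def intro!: algebraic_set_Inter)
    moreover have "\<Inter>D \<subseteq> X" using \<open>D \<noteq> {}\<close> D(2) by blast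
    moreover have "min_cut_ge k (\<Inter>D)" by (rule chain_Inter_hard[OF \<open>D \<noteq> {}\<close> chain D(1)])
    ultimately show "\<Union>E \<in> C" by (simp add: C_def eq)
  qed
  then obtain M where M: "M \<in> C" "\<And>W. W \<in> C \<Longrightarrow> M \<subseteq> W \<Longrightarrow> W = M" by blast
  show ?thesis
  proof (rule that[of "- M"])
    show "Z = - M" if "closed_cone Z" "Z \<subseteq> - M" "min_cut_ge k Z" for Z
    proof -
      have "- Z \<in> C" using that M(1) by (auto simp: C_def)
      moreover have "M \<subseteq> - Z" using that(2) by blast
      ultimately show ?thesis using M(2)[of "- Z"] by blast
    qed
  qed (use M(1) in \<open>auto simp: C_def\<close>)
qed

lemma irreducible_origin: "irreducible_algebraic_set {0 :: complex ^ 'n::finite}"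
  unfolding irreducible_algebraic_set_def
proof (intro conjI allI impI)
  show "algebraic_set {0 :: complex ^ 'n}"
    by (rule algebraic_setI[of "range (\<lambda>i x. x $ i)"]) (auto simp: polyfuns_coord vec_eq_iff)
  fix A B :: "(complex ^ 'n) set"
  assume "algebraic_set A \<and> algebraic_set B \<and> {0} = A \<union> B"
  then show "{0} = A \<or> {0} = B" by blast
qed simp

text \<open>
  A minimal cone \<open>Y\<close> inside \<open>X\<close> that is hard to cut is the top of the chain.  It is irreducible and larger
  than the origin, so some coordinate does not vanish on it, and cutting \<open>Y\<close> by this coordinate yields
  a strictly smaller cone that is at most one step easier to cut.
\<close>

theorem hard_cone_has_chain:
  fixes X :: "(complex ^ 'n::finite) set"
  assumes "closed_cone X" "0 \<in> X" "min_cut_ge k X"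
  shows "irreducible_chain k X"
  using assms
proof (induction k arbitrary: X)
  case 0
  then show ?case unfolding irreducible_chain_def
    by (intro exI[of _ "\<lambda>_. {0}"]) (simp add: irreducible_origin)
next
  case (Suc k)
  obtain Y where Y: "closed_cone Y" "Y \<subseteq> X" "min_cut_ge (Suc k) Y"
    and minimal: "\<And>Z. closed_cone Z \<Longrightarrow> Z \<subseteq> Y \<Longrightarrow> min_cut_ge (Suc k) Z \<Longrightarrow> Z = Y"
    using minimal_hard_cone_exists[OF Suc.prems(1,3)] by blast
  have irr: "irreducible_algebraic_set Y"
    by (rule minimal_hard_cone_irreducible[OF Y(1,3) minimal])
  have "\<not> cuts_to_origin [] Y" using Y(3) by (simp add: min_cut_ge_def)
  then obtain x where x: "x \<in> Y" "x \<noteq> 0" by (auto simp: cuts_to_origin_def)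
  then obtain i where i: "x $ i \<noteq> 0" by (auto simp: vec_eq_iff)
  define a :: "complex ^ 'n" where "a = axis i 1"
  define Y' where "Y' = Y \<inter> {x. lform a x = 0}"
  have "closed_cone Y'"
    using Y(1) by (auto simp: Y'_def closed_cone_def lform_scale
        intro!: algebraic_set_Int algebraic_set_zero_locus lform_in_polyfuns)
  moreover have "0 \<in> Y'"
  proof -
    have "0 *s x \<in> Y" using Y(1) x(1) unfolding closed_cone_def by blast
    then have "0 \<in> Y" by simp
    then show ?thesis by (simp add: Y'_def a_def lform_axis)
  qed
  moreover have "min_cut_ge k Y'"
    unfolding min_cut_ge_def
  proof (intro allI impI notI)
    fix as assume "length as < k" "cuts_to_origin as Y'"
    then have "cuts_to_origin (a # as) Y" by (auto simp: cuts_to_origin_def Y'_def)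
    then show False using Y(3) \<open>length as < k\<close> by (auto simp: min_cut_ge_def)
  qed
  ultimately have "irreducible_chain k Y'" by (rule Suc.IH)
  then obtain Z where Z: "\<And>i. i \<le> k \<Longrightarrow> irreducible_algebraic_set (Z i) \<and> Z i \<subseteq> Y'"
    "\<And>i. i < k \<Longrightarrow> Z i \<subset> Z (Suc i)"
    by (auto simp: irreducible_chain_def)
  have "Y' \<subset> Y" using x(1) i by (auto simp: Y'_def a_def lform_axis)
  then have "\<forall>i\<le>Suc k. irreducible_algebraic_set ((Z(Suc k := Y)) i) \<and> (Z(Suc k := Y)) i \<subseteq> X"
    using Z(1) irr Y(2) by (auto simp: le_Suc_eq)
  moreover have "\<forall>i<Suc k. (Z(Suc k := Y)) i \<subset> (Z(Suc k := Y)) (Suc i)"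
    using Z(1)[of k] Z(2) \<open>Y' \<subset> Y\<close> by (auto simp: less_Suc_eq)
  ultimately show ?case unfolding irreducible_chain_def by blast
qed

section \<open>Codimension of an intersection of cones\<close>

lemma closed_cone_UNIV: "closed_cone UNIV"
  using algebraic_setI[of "{}" UNIV] by (simp add: closed_cone_def)

text \<open>
  The dimension inequality for intersections of cones: chains in \<open>X\<close> and \<open>Y\<close> give independent
  functions, and their number bounds from below how many linear forms are needed to cut \<open>X \<inter> Y\<close>.
\<close>

lemma irreducible_chain_Int:
  fixes X Y :: "(complex ^ 'n::finite) set"
  assumes X: "closed_cone X" "0 \<in> X" "irreducible_chain a X"
    and Y: "closed_cone Y" "0 \<in> Y" "irreducible_chain b Y"
  shows "irreducible_chain (a + b - CARD('n)) (X \<inter> Y)"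
proof (rule hard_cone_has_chain)
  show "closed_cone (X \<inter> Y)" using X(1) Y(1) by (auto simp: closed_cone_def algebraic_set_Int)
  show "0 \<in> X \<inter> Y" using X(2) Y(2) by simp
  obtain fs where fs: "length fs = a" "set fs \<subseteq> polyfuns" "alg_indep X fs"
    using irreducible_chain_imp_alg_indep[OF X(3)] by blast
  obtain gs where gs: "length gs = b" "set gs \<subseteq> polyfuns" "alg_indep Y gs"
    using irreducible_chain_imp_alg_indep[OF Y(3)] by blast
  show "min_cut_ge (a + b - CARD('n)) (X \<inter> Y)"
    unfolding min_cut_ge_def
    using alg_indep_Int_bound[OF X(1) fs(2,3) Y(1) gs(2,3)] fs(1) gs(1) by fastforce
qed

lemma irreducible_chain_le:
  fixes X :: "(complex ^ 'n::finite) set"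
  assumes "irreducible_chain k X"
  shows "k \<le> CARD('n)"
proof -
  obtain fs where fs: "length fs = k" "set fs \<subseteq> polyfuns" "alg_indep X fs"
    using irreducible_chain_imp_alg_indep[OF assms] by blast
  obtain as :: "(complex ^ 'n) list" where as: "length as = CARD('n)" "cuts_to_origin as UNIV"
    by (rule coordinate_forms_cut)
  show ?thesis
    using alg_indep_length_le[OF closed_cone_UNIV as(2) fs(2) alg_indep_mono[OF fs(3)]] fs(1) as(1) by simp
qed

lemma krull_dim_eq: "krull_dim X = Sup {enat k | k. irreducible_chain k X}"
  by (simp add: krull_dim_def irreducible_chain_def)

lemma krull_dim_ge: "irreducible_chain k X \<Longrightarrow> enat k \<le> krull_dim X"
  unfolding krull_dim_eq by (rule Sup_upper) blast

lemma krull_dim_mono: "X \<subseteq> Y \<Longrightarrow> krull_dim X \<le> krull_dim Y"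
  unfolding krull_dim_def by (rule Sup_subset_mono) blast

text \<open>
  The dimension is finite and at most \<open>CARD('n)\<close>, so that the truncated subtraction in the definition
  of codimension does not lose information.
\<close>

lemma krull_dim_attained:
  fixes X :: "(complex ^ 'n::finite) set"
  assumes "0 \<in> X"
  obtains k where "irreducible_chain k X" "krull_dim X = enat k" "k \<le> CARD('n)"
proof -
  define K where "K = {k. irreducible_chain k X}"
  have "irreducible_chain 0 X"
    unfolding irreducible_chain_def using assms
    by (intro exI[of _ "\<lambda>_. {0}"]) (simp add: irreducible_origin)
  then have "K \<noteq> {}" by (auto simp: K_def)
  have "K \<subseteq> {..CARD('n)}" using irreducible_chain_le by (auto simp: K_def)
  then have "finite K" by (rule finite_subset) simp
  have "irreducible_chain (Max K) X" using Max_in[OF \<open>finite K\<close> \<open>K \<noteq> {}\<close>] by (simp add: K_def)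
  moreover have "krull_dim X = enat (Max K)"
  proof (rule antisym)
    show "krull_dim X \<le> enat (Max K)"
      unfolding krull_dim_eq using Max_ge[OF \<open>finite K\<close>] by (intro Sup_least) (auto simp: K_def)
  qed (rule krull_dim_ge[OF calculation])
  ultimately show ?thesis using that irreducible_chain_le by blast
qed

theorem codim_Int_le:
  fixes X Y :: "(complex ^ 'n::finite) set"
  assumes X: "closed_cone X" "0 \<in> X" and Y: "closed_cone Y" "0 \<in> Y"
  shows "codim (X \<inter> Y) \<le> codim X + codim Y"
proof -
  obtain a where a: "irreducible_chain a X" "krull_dim X = enat a" "a \<le> CARD('n)"
    using krull_dim_attained[OF X(2)] .
  obtain b where b: "irreducible_chain b Y" "krull_dim Y = enat b" "b \<le> CARD('n)"
    using krull_dim_attained[OF Y(2)] .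
  obtain c where c: "irreducible_chain c (X \<inter> Y)" "krull_dim (X \<inter> Y) = enat c" "c \<le> CARD('n)"
    using krull_dim_attained[of "X \<inter> Y"] X(2) Y(2) by blast
  have "enat (a + b - CARD('n)) \<le> enat c"
    using krull_dim_ge[OF irreducible_chain_Int[OF X a(1) Y b(1)]] c(2) by simp
  then show ?thesis using a(2,3) b(2,3) c(2,3) by (simp add: codim_def)
qed

lemma codim_antimono: "X \<subseteq> Y \<Longrightarrow> codim Y \<le> codim X"
proof -
  have minus_antimono: "n - q \<le> n - p" if "p \<le> q" for n p q :: enat
    using that by (cases n; cases p; cases q) auto
  assume "X \<subseteq> Y"
  then show ?thesis unfolding codim_def by (intro minus_antimono krull_dim_mono)
qed

section \<open>The singular cone of a form\<close>

lemma partial_deriv_superset: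
  assumes "finite K" "Poly_Mapping.keys p \<subseteq> K"
  shows "partial_deriv i p = (\<Sum>m\<in>K. Poly_Mapping.single (m - Poly_Mapping.single i 1)
          (of_nat (Poly_Mapping.lookup m i) * Poly_Mapping.lookup p m))"
  unfolding partial_deriv_def
  by (rule sum.mono_neutral_left) (use assms in \<open>auto simp: in_keys_iff\<close>)

lemma partial_deriv_add: "partial_deriv i (p + q) = partial_deriv i p + partial_deriv i q"
proof -
  let ?K = "Poly_Mapping.keys p \<union> Poly_Mapping.keys q"
  have "finite ?K" "Poly_Mapping.keys (p + q) \<subseteq> ?K" by (auto simp: Poly_Mapping.keys_add)
  then show ?thesis
    by (simp add: partial_deriv_superset[of ?K] lookup_add sum.distrib distrib_left single_add)
qed

lemma assoc_poly_add: "assoc_poly d (S + T) = assoc_poly d S + assoc_poly d T"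
  by (simp add: assoc_poly_def single_add sum.distrib)

lemma keys_assoc_poly:
  fixes T :: "'n::finite list \<Rightarrow> complex"
  assumes "m \<in> Poly_Mapping.keys (assoc_poly d T)"
  shows "(\<Sum>k\<in>UNIV. Poly_Mapping.lookup m k) = d"
proof -
  have deg: "(\<Sum>k\<in>UNIV. Poly_Mapping.lookup (\<Sum>i\<leftarrow>I. Poly_Mapping.single i (1::nat)) k) = length I"
    for I :: "'n list"
    by (induction I) (auto simp: lookup_add sum.distrib lookup_single when_def)
  have "Poly_Mapping.keys (assoc_poly d T) \<subseteq>
      (\<Union>I\<in>{I. length I = d}. Poly_Mapping.keys (Poly_Mapping.single (\<Sum>i\<leftarrow>I. Poly_Mapping.single i (1::nat)) (T I)))"
    unfolding assoc_poly_def by (rule keys_sum)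
  then obtain I where "length I = d" "m = (\<Sum>i\<leftarrow>I. Poly_Mapping.single i 1)"
    using assms by (auto split: if_splits)
  then show ?thesis using deg by simp
qed

text \<open>
  The partial derivatives of a form of degree \<open>d\<close> are forms of degree \<open>d - 1\<close>, so the singular locus is a
  cone.
\<close>

lemma partial_deriv_assoc_poly_scale:
  fixes T :: "'n::finite list \<Rightarrow> complex"
  shows "eval_poly (partial_deriv i (assoc_poly d T)) (c *s x)
       = c ^ (d - 1) * eval_poly (partial_deriv i (assoc_poly d T)) x"
proof -
  have "of_nat (Poly_Mapping.lookup m i) * (\<Prod>k\<in>UNIV. ((c *s x) $ k) ^ Poly_Mapping.lookup (m - Poly_Mapping.single i 1) k)
      = c ^ (d - 1) * (of_nat (Poly_Mapping.lookup m i) * (\<Prod>k\<in>UNIV. (x $ k) ^ Poly_Mapping.lookup (m - Poly_Mapping.single i 1) k))"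
    if "m \<in> Poly_Mapping.keys (assoc_poly d T)" for m
  proof (cases "Poly_Mapping.lookup m i = 0")
    case False
    let ?n = "m - Poly_Mapping.single i 1"
    have "m = ?n + Poly_Mapping.single i 1"
      using False by (intro poly_mapping_eqI) (auto simp: lookup_add lookup_minus lookup_single when_def)
    then have "(\<Sum>k\<in>UNIV. Poly_Mapping.lookup m k)
        = (\<Sum>k\<in>UNIV. Poly_Mapping.lookup (?n + Poly_Mapping.single i 1) k)" by simp
    also have "\<dots> = (\<Sum>k\<in>UNIV. Poly_Mapping.lookup ?n k) + 1"
      by (simp add: lookup_add sum.distrib lookup_single when_def del: lookup_minus)
    finally have "(\<Sum>k\<in>UNIV. Poly_Mapping.lookup ?n k) = d - 1"
      using keys_assoc_poly[OF that] by simp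
    then show ?thesis
      by (simp add: power_mult_distrib prod.distrib power_sum[symmetric] del: lookup_minus)
  qed simp
  then have "Poly_Mapping.lookup (assoc_poly d T) m *
        (of_nat (Poly_Mapping.lookup m i) * (\<Prod>k\<in>UNIV. ((c *s x) $ k) ^ Poly_Mapping.lookup (m - Poly_Mapping.single i 1) k))
      = Poly_Mapping.lookup (assoc_poly d T) m * (c ^ (d - 1) * (of_nat (Poly_Mapping.lookup m i) *
        (\<Prod>k\<in>UNIV. (x $ k) ^ Poly_Mapping.lookup (m - Poly_Mapping.single i 1) k)))"
    if "m \<in> Poly_Mapping.keys (assoc_poly d T)" for m
    using that by simp
  then show ?thesis
    unfolding partial_deriv_def eval_poly_sum eval_poly_single sum_distrib_left
    by (intro sum.cong) (simp_all add: mult_ac del: lookup_minus vector_smult_component)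
qed

definition sing_cone :: "nat \<Rightarrow> ('n::finite list \<Rightarrow> complex) \<Rightarrow> (complex ^ 'n) set" where
  "sing_cone d T = {x. \<forall>i. eval_poly (partial_deriv i (assoc_poly d T)) x = 0}"

lemma closed_cone_sing_cone: "closed_cone (sing_cone d T)"
proof -
  have "algebraic_set (sing_cone d T)"
    unfolding algebraic_set_def sing_cone_def
    by (intro exI[of _ "range (\<lambda>i. partial_deriv i (assoc_poly d T))"]) auto
  then show ?thesis by (auto simp: closed_cone_def sing_cone_def partial_deriv_assoc_poly_scale)
qed

lemma origin_in_sing_cone:
  assumes "d \<ge> 2"
  shows "0 \<in> sing_cone d T"
  unfolding sing_cone_def
proof (intro CollectI allI)
  fix i
  show "eval_poly (partial_deriv i (assoc_poly d T)) 0 = 0"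
    using partial_deriv_assoc_poly_scale[of i d T 0 0] assms
    by (simp add: power_0_left split: if_splits)
qed

lemma sing_cone_Int_subset: "sing_cone d S \<inter> sing_cone d T \<subseteq> sing_cone d (S + T)"
  by (auto simp: sing_cone_def assoc_poly_add partial_deriv_add eval_poly_add)

theorem lemma3p3:
  fixes d :: nat and S T :: "'n::finite list \<Rightarrow> complex"
  assumes "d \<ge> 2"
    and "S \<in> symmetric_tensors d"
    and "T \<in> symmetric_tensors d"
  shows "sgr d (S + T) \<le> sgr d S + sgr d T"
proof -
  have sgr: "sgr d U = codim (sing_cone d U)" for U :: "'n list \<Rightarrow> complex"
    by (simp add: sgr_def sing_cone_def)
  have "codim (sing_cone d (S + T)) \<le> codim (sing_cone d S \<inter> sing_cone d T)"
    by (rule codim_antimono[OF sing_cone_Int_subset])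
  also have "\<dots> \<le> codim (sing_cone d S) + codim (sing_cone d T)"
    by (intro codim_Int_le closed_cone_sing_cone origin_in_sing_cone assms(1))
  finally show ?thesis by (simp add: sgr)
qed

end
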